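(* Let $\mathcal{D}\subset\mathbb{R}^2$ be a balanced quadriculated disk with domino group $G_{\mathcal{D}}$ and even domino group $G^+_{\mathcal{D}}$. Let $K < G_{\mathcal{D}}$ be a subgroup (not necessarily normal) of finite index $n$ with $K \not\subseteq G^{+}_{\mathcal{D}}$. Let $G_{\mathcal{D}}/K$ denote either the left coset space $\{gK;\ g\in G_{\mathcal{D}}\}$ or the right coset space $\{Kg;\ g\in G_{\mathcal{D}}\}$, and let $\psi: G_{\mathcal{D}} \to G_{\mathcal{D}}/K$ be the quotient map. For each $N$, let $\mathbf{T}$ be a random tiling of $\mathcal{R}_N=\mathcal{D}\times[0,N]$ and consider the random variable $\mathbf{X}_N = \psi(\mathbf{T})$ with values in the finite set $G_{\mathcal{D}}/K$. Then the random variables $\mathbf{X}_N$ converge in distribution to the uniform distribution in $G_{\mathcal{D}}/K$; that is, for every $x \in G_{\mathcal{D}}/K$, $$\lim_{N\to\infty}\operatorname{Prob}[\mathbf{X}_N=x]=\frac1n.$$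
   Context: Quadriculated disk: a set $\mathcal{D}\subset\mathbb{R}^2$ which is the union of finitely many closed unit squares with vertices in $\mathbb{Z}^2$ and is homeomorphic to the closed unit disk. It is balanced if, in the checkerboard coloring, it has equal numbers of white and black squares. Tilings: $\mathcal{R}_N=\mathcal{D}\times[0,N]\subset\mathbb{R}^3$ is a union of closed unit cubes with vertices in $\mathbb{Z}^3$. A domino is the union of two unit cubes sharing a face; a tiling is a set of dominoes with disjoint interiors whose union is $\mathcal{R}_N$. $\mathcal{T}(\mathcal{R}_N)$ is the set of tilings; a random tiling is uniformly distributed in $\mathcal{T}(\mathcal{R}_N)$ (nonempty for all sufficiently large $N$). For $N$ even, $\mathbf{t}_{\mathrm{vert},N}$ is the tiling of $\mathcal{R}_N$ with all dominoes vertical (in the third direction). Concatenation (stacking) of $\mathbf{t}_0\in\mathcal{T}(\mathcal{R}_{N_0})$ and $\mathbf{t}_1\in\mathcal{T}(\mathcal{R}_{N_1})$ is $\mathbf{t}_0\ast\mathbf{t}_1\in\mathcal{T}(\mathcal{R}_{N_0+N_1})$. Domino group: a flip removes two adjacent parallel dominoes (whose union is a $2\times2\times1$ block) and places them back in the other position. $\mathbf{t}_0\approx\mathbf{t}_1$ means the two tilings of $\mathcal{R}_N$ are joined by a finite sequence of flips. For $\mathbf{t}_i\in\mathcal{T}(\mathcal{R}_{N_i})$ with $N_0\equiv N_1\pmod 2$, write $\mathbf{t}_0\sim\mathbf{t}_1$ if there exists $N\equiv N_0\pmod 2$, $N\ge\max\{N_0,N_1\}$, with $\mathbf{t}_0\ast\mathbf{t}_{\mathrm{vert},N-N_0}\approx\mathbf{t}_1\ast\mathbf{t}_{\mathrm{vert},N-N_1}$.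 The domino group $G_{\mathcal{D}}$ is the set of $\sim$-classes of tilings of $\mathcal{R}_N$ (all $N$) with operation induced by $\ast$; it is a group with identity the class of vertical tilings. $G^+_{\mathcal{D}}<G_{\mathcal{D}}$ is the kernel of the homomorphism $G_{\mathcal{D}}\to\mathbb{Z}/(2)$ taking the class of $\mathbf{t}\in\mathcal{T}(\mathcal{R}_N)$ to $N\bmod 2$. For a tiling $\mathbf{t}$, $\psi(\mathbf{t})$ denotes $\psi$ applied to its class in $G_{\mathcal{D}}$. *)

theory Defs
  imports "HOL-Probability.Probability" "HOL-Algebra.Left_Coset" "HOL-Algebra.Elementary_Groups"
begin

type_synonym plane = "real \<times> real"
type_synonym space = "plane \<times> real"
type_synonym tiling = "space set set"

text \<open>Unit squares and cubes are indexed by their corner with the smallest coordinates.\<close>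

definition unit_square :: "int \<times> int \<Rightarrow> plane set" where
  "unit_square p = {real_of_int (fst p)..real_of_int (fst p) + 1}
                 \<times> {real_of_int (snd p)..real_of_int (snd p) + 1}"

definition quadriculated_disk :: "plane set \<Rightarrow> bool" where
  "quadriculated_disk D \<longleftrightarrow>
     (\<exists>S. finite S \<and> D = (\<Union>p\<in>S. unit_square p)) \<and> D homeomorphic cball (0 :: plane) 1"

definition balanced :: "plane set \<Rightarrow> bool" where
  "balanced D \<longleftrightarrow>
     card {p. unit_square p \<subseteq> D \<and> even (fst p + snd p)} =
     card {p. unit_square p \<subseteq> D \<and> odd (fst p + snd p)}"

definition unit_cube :: "(int \<times> int) \<times> int \<Rightarrow> space set" where
  "unit_cube c = unit_square (fst c) \<times> {real_of_int (snd c)..real_of_int (snd c) + 1}"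

definition share_face :: "(int \<times> int) \<times> int \<Rightarrow> (int \<times> int) \<times> int \<Rightarrow> bool" where
  "share_face c c' \<longleftrightarrow>
     \<bar>fst (fst c) - fst (fst c')\<bar> + \<bar>snd (fst c) - snd (fst c')\<bar> + \<bar>snd c - snd c'\<bar> = 1"

definition domino :: "space set \<Rightarrow> bool" where
  "domino d \<longleftrightarrow> (\<exists>c c'. share_face c c' \<and> d = unit_cube c \<union> unit_cube c')"

definition cylinder :: "plane set \<Rightarrow> nat \<Rightarrow> space set" where
  "cylinder D N = D \<times> {0..real N}"

text \<open>For \<open>D \<noteq> {}\<close> and \<open>N = 0\<close> the region is flat and has no tilings. This affects neither the
  domino group (its identity is represented by the vertical tiling of height 2) nor limits in \<open>N\<close>.\<close>

definition tilings :: "plane set \<Rightarrow> nat \<Rightarrow> tiling set" where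
  "tilings D N = {t. (\<forall>d\<in>t. domino d) \<and>
                     (\<forall>d\<in>t. \<forall>e\<in>t. d \<noteq> e \<longrightarrow> interior d \<inter> interior e = {}) \<and>
                     \<Union>t = cylinder D N}"

text \<open>This is used for even \<open>N\<close> only; for \<open>N = 0\<close> it is empty, hence neutral for concatenation.\<close>

definition vertical_tiling :: "plane set \<Rightarrow> nat \<Rightarrow> tiling" where
  "vertical_tiling D N =
     {unit_cube (p, 2 * int k) \<union> unit_cube (p, 2 * int k + 1) | p k.
        unit_square p \<subseteq> D \<and> 2 * k + 1 < N}"

definition stack :: "nat \<Rightarrow> tiling \<Rightarrow> tiling \<Rightarrow> tiling" where
  "stack N\<^sub>0 t\<^sub>0 t\<^sub>1 = t\<^sub>0 \<union> (\<lambda>d. (\<lambda>x. x + ((0, 0), real N\<^sub>0)) ` d) ` t\<^sub>1"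

definition flip_block :: "space set \<Rightarrow> bool" where
  "flip_block B \<longleftrightarrow>
     (\<exists>(a::int) (b::int) (c::int) l m n.
        (l, m, n) \<in> {(2, 2, 1), (2, 1, 2), (1, 2, 2)} \<and>
        B = ({real_of_int a..real_of_int a + l} \<times> {real_of_int b..real_of_int b + m})
            \<times> {real_of_int c..real_of_int c + n})"

text \<open>Two dominoes with disjoint interiors whose union is a \<open>2 \<times> 2 \<times> 1\<close> block are parallel, and there
  are exactly two such pairs in each block.\<close>

definition flip :: "tiling \<Rightarrow> tiling \<Rightarrow> bool" where
  "flip t t' \<longleftrightarrow>
     (\<exists>d\<^sub>0 d\<^sub>1 e\<^sub>0 e\<^sub>1. d\<^sub>0 \<in> t \<and> d\<^sub>1 \<in> t \<and> domino e\<^sub>0 \<and> domino e\<^sub>1 \<and>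
        interior e\<^sub>0 \<inter> interior e\<^sub>1 = {} \<and>
        flip_block (d\<^sub>0 \<union> d\<^sub>1) \<and> e\<^sub>0 \<union> e\<^sub>1 = d\<^sub>0 \<union> d\<^sub>1 \<and> {e\<^sub>0, e\<^sub>1} \<noteq> {d\<^sub>0, d\<^sub>1} \<and>
        t' = (t - {d\<^sub>0, d\<^sub>1}) \<union> {e\<^sub>0, e\<^sub>1})"

definition flip_connected :: "plane set \<Rightarrow> nat \<Rightarrow> tiling \<Rightarrow> tiling \<Rightarrow> bool" where
  "flip_connected D N = (\<lambda>t t'. t \<in> tilings D N \<and> t' \<in> tilings D N \<and> flip t t')\<^sup>*\<^sup>*"

text \<open>A tiling is paired with the height of the region it tiles.\<close>

definition all_tilings :: "plane set \<Rightarrow> (nat \<times> tiling) set" where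
  "all_tilings D = (SIGMA N:UNIV. tilings D N)"

definition domino_rel :: "plane set \<Rightarrow> ((nat \<times> tiling) \<times> (nat \<times> tiling)) set" where
  "domino_rel D =
     {((N\<^sub>0, t\<^sub>0), (N\<^sub>1, t\<^sub>1)). (N\<^sub>0, t\<^sub>0) \<in> all_tilings D \<and> (N\<^sub>1, t\<^sub>1) \<in> all_tilings D \<and>
        N\<^sub>0 mod 2 = N\<^sub>1 mod 2 \<and>
        (\<exists>N. N mod 2 = N\<^sub>0 mod 2 \<and> max N\<^sub>0 N\<^sub>1 \<le> N \<and>
             flip_connected D N (stack N\<^sub>0 t\<^sub>0 (vertical_tiling D (N - N\<^sub>0)))
                                (stack N\<^sub>1 t\<^sub>1 (vertical_tiling D (N - N\<^sub>1))))}"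

definition domino_class :: "plane set \<Rightarrow> nat \<Rightarrow> tiling \<Rightarrow> (nat \<times> tiling) set" where
  "domino_class D N t = domino_rel D `` {(N, t)}"

definition domino_group :: "plane set \<Rightarrow> (nat \<times> tiling) set monoid" where
  "domino_group D =
     \<lparr>carrier = all_tilings D // domino_rel D,
      monoid.mult = (\<lambda>X Y. \<Union>(N\<^sub>0, t\<^sub>0)\<in>X. \<Union>(N\<^sub>1, t\<^sub>1)\<in>Y. domino_class D (N\<^sub>0 + N\<^sub>1) (stack N\<^sub>0 t\<^sub>0 t\<^sub>1)),
      one = domino_class D 2 (vertical_tiling D 2)\<rparr>"

definition domino_parity :: "(nat \<times> tiling) set \<Rightarrow> int" where
  "domino_parity X = the_elem ((\<lambda>(N, t). int N mod 2) ` X)"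

definition even_domino_group :: "plane set \<Rightarrow> (nat \<times> tiling) set set" where
  "even_domino_group D = kernel (domino_group D) (integer_mod_group 2) domino_parity"

end

theory Submission
  imports Defs
begin

text \<open>Why the limit is uniform.

  Cut a tiling of \<open>D \<times> [0, N]\<close> by the horizontal planes of integral height. Between two floors one
  sees a \<^emph>\<open>plug\<close>, the set of unit squares crossed by vertical dominoes, so a tiling is a walk of
  length \<open>N\<close> from the empty plug to the empty plug in a finite graph whose edges are the possible
  floors (\<open>tilings_bij\<close>). Stacking is concatenation of walks.

  The domino group is understood through two moves on walks. Two floors without horizontal dominoes
  can be pushed through any floor by flips (\<open>vertical_passes_layer\<close>), and a walk followed by its
  mirror image can be flipped into vertical floors (\<open>walk_reflect_equiv\<close>). Therefore vertical
  padding is harmless, mirror images are inverses, and a detour \<open>s @ reflect s\<close> may be inserted at any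
  plug without changing the class (\<open>sim_cancel\<close>). The last point attaches a group element to a walk
  between two arbitrary plugs, once a completion of every plug to the empty plug has been fixed.

  Now consider the right cosets of \<open>K\<close>. A block of \<open>m\<close> consecutive floors between given plugs acts on
  the cosets by a permutation. Cosets are permuted transitively, and an element of \<open>K\<close> of odd height
  removes the parity obstruction; hence for some \<open>m\<close> the blocks between any two plugs move any coset
  to any other (\<open>eventually_mixing\<close>). Given the plugs at the heights where blocks meet, the blocks of a
  random tiling are independent and uniform, so the distribution of the coset is a product of doubly
  stochastic matrices whose entries are bounded below. Such a product converges to the uniform
  distribution exponentially fast, whatever the plugs are. In the formal proof this is an
  estimate on counts: for each plug, the relative deviation of the number of walks with a given
  coset from the mean over all cosets shrinks by a fixed factor with every block
  (\<open>coset_count_near_mean\<close>). No information about the growth of the number of tilings is required.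

  Left cosets follow by reflecting tilings, which inverts their classes (\<open>left_coset_limit\<close>).\<close>

section \<open>Regions made of unit cubes\<close>

type_synonym cell = "int \<times> int"
type_synonym cube = "cell \<times> int"

definition solid :: "cube set \<Rightarrow> space set" where
  "solid X = \<Union>(unit_cube ` X)"

definition centre :: "cube \<Rightarrow> space" where
  "centre c = ((real_of_int (fst (fst c)) + 1/2, real_of_int (snd (fst c)) + 1/2),
               real_of_int (snd c) + 1/2)"

lemma int_half_between:
  fixes a b :: int
  assumes "real_of_int b \<le> real_of_int a + 1/2" "real_of_int a + 1/2 \<le> real_of_int b + 1"
  shows "a = b"
  using assms by linarith

text \<open>The centre of a cube lies in no other closed unit cube, so centres detect which cubes make up
  a union of cubes; all comparisons of solids below reduce to comparisons of sets of cubes.\<close>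

lemma centre_in_unit_cube [simp]: "centre c \<in> unit_cube c' \<longleftrightarrow> c = c'"
proof
  assume "centre c \<in> unit_cube c'"
  then show "c = c'"
    by (cases c, cases c')
      (auto simp: centre_def unit_cube_def unit_square_def intro!: int_half_between prod_eqI)
qed (auto simp: centre_def unit_cube_def unit_square_def)

lemma centre_in_solid [simp]: "centre c \<in> solid X \<longleftrightarrow> c \<in> X"
  by (auto simp: solid_def)

lemma solid_subset_iff [simp]: "solid X \<subseteq> solid Y \<longleftrightarrow> X \<subseteq> Y"
proof
  assume "solid X \<subseteq> solid Y"
  then show "X \<subseteq> Y"
    using centre_in_solid by blast
qed (auto simp: solid_def)

lemma solid_eq_iff [simp]: "solid X = solid Y \<longleftrightarrow> X = Y"
  by (metis solid_subset_iff subset_antisym subset_refl)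

lemma inj_solid: "inj solid"
  by (simp add: inj_on_def)

lemma solid_Un: "solid (X \<union> Y) = solid X \<union> solid Y"
  by (auto simp: solid_def)

lemma solid_Union: "solid (\<Union>T) = \<Union>(solid ` T)"
  by (auto simp: solid_def)

lemma centre_interior: "c \<in> X \<Longrightarrow> centre c \<in> interior (solid X)"
proof -
  assume c: "c \<in> X"
  let ?B = "({real_of_int (fst (fst c))<..<of_int (fst (fst c)) + 1} \<times>
             {real_of_int (snd (fst c))<..<of_int (snd (fst c)) + 1}) \<times>
             {real_of_int (snd c)<..<of_int (snd c) + (1::real)}"
  have "open ?B"
    by (intro open_Times) auto
  moreover have "?B \<subseteq> solid X"
    using c by (force simp: solid_def unit_cube_def unit_square_def)
  moreover have "centre c \<in> ?B"
    by (auto simp: centre_def)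
  ultimately show ?thesis
    by (meson interior_maximal subsetD)
qed

lemma eventually_in_open_cell:
  fixes x :: real
  shows "eventually (\<lambda>d. of_int \<lfloor>x\<rfloor> < x + d \<and> x + d < of_int \<lfloor>x\<rfloor> + 1) (at_right 0)"
proof -
  have "eventually (\<lambda>d. 0 < d \<and> d < of_int \<lfloor>x\<rfloor> + 1 - x) (at_right (0::real))"
    using eventually_at_right_real[of 0 "of_int \<lfloor>x\<rfloor> + 1 - x"]
    by simp
  then show ?thesis
    by (rule eventually_mono) (use of_int_floor_le[of x] in linarith)
qed

text \<open>A point of an open set can be moved slightly in the direction \<open>(1,1,1)\<close> without leaving the
  set; for small steps this makes all coordinates non-integral, and such a point lies in only one
  closed unit cube.\<close>

lemma open_meets_open_cube:
  fixes W :: "space set"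
  assumes "open W" "W \<noteq> {}"
  shows "\<exists>z c. z \<in> W \<and> (\<forall>c'. z \<in> unit_cube c' \<longrightarrow> c' = c)"
proof -
  obtain x y w where z: "((x, y), w) \<in> W"
    using assms(2) by auto
  have "((\<lambda>d. ((x + d, y + d), w + d)) \<longlongrightarrow> ((x + 0, y + 0), w + 0)) (at_right (0::real))"
    by (intro tendsto_intros)
  then have "eventually (\<lambda>d. ((x + d, y + d), w + d) \<in> W) (at_right 0)"
    by (rule topological_tendstoD) (use assms z in auto)
  then have "eventually (\<lambda>d. ((x + d, y + d), w + d) \<in> W
      \<and> (of_int \<lfloor>x\<rfloor> < x + d \<and> x + d < of_int \<lfloor>x\<rfloor> + 1)
      \<and> (of_int \<lfloor>y\<rfloor> < y + d \<and> y + d < of_int \<lfloor>y\<rfloor> + 1)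
      \<and> (of_int \<lfloor>w\<rfloor> < w + d \<and> w + d < of_int \<lfloor>w\<rfloor> + 1)) (at_right 0)"
    by (intro eventually_conj eventually_in_open_cell)
  then obtain d where d: "((x + d, y + d), w + d) \<in> W"
      "of_int \<lfloor>x\<rfloor> < x + d" "x + d < of_int \<lfloor>x\<rfloor> + 1"
      "of_int \<lfloor>y\<rfloor> < y + d" "y + d < of_int \<lfloor>y\<rfloor> + 1"
      "of_int \<lfloor>w\<rfloor> < w + d" "w + d < of_int \<lfloor>w\<rfloor> + 1"
    using eventually_happens'[OF trivial_limit_at_right_real] by blast
  have uniq: "a = \<lfloor>u\<rfloor>" if "of_int \<lfloor>u\<rfloor> < u + d" "u + d < of_int \<lfloor>u\<rfloor> + 1"
      "real_of_int a \<le> u + d" "u + d \<le> real_of_int a + 1" for a u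
    using that by linarith
  have "c' = ((\<lfloor>x\<rfloor>, \<lfloor>y\<rfloor>), \<lfloor>w\<rfloor>)" if "((x + d, y + d), w + d) \<in> unit_cube c'" for c'
    using that d(2-) by (cases c') (auto simp: unit_cube_def unit_square_def intro!: uniq)
  with d(1) show ?thesis
    by blast
qed

text \<open>This removes topology from the definition of a tiling: disjointness of interiors becomes
  disjointness of sets of cubes.\<close>

lemma interior_solid_disjoint_iff:
  "interior (solid X) \<inter> interior (solid Y) = {} \<longleftrightarrow> X \<inter> Y = {}"
proof
  assume "interior (solid X) \<inter> interior (solid Y) = {}"
  then show "X \<inter> Y = {}"
    using centre_interior by blast
next
  assume disj: "X \<inter> Y = {}"
  show "interior (solid X) \<inter> interior (solid Y) = {}"
  proof (rule ccontr)
    assume "interior (solid X) \<inter> interior (solid Y) \<noteq> {}"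
    then obtain z c where z: "z \<in> interior (solid X) \<inter> interior (solid Y)"
        and c: "\<And>c'. z \<in> unit_cube c' \<Longrightarrow> c' = c"
      using open_meets_open_cube[OF open_Int[OF open_interior open_interior]] by metis
    have "z \<in> solid X" "z \<in> solid Y"
      using z interior_subset by blast+
    then obtain c\<^sub>1 c\<^sub>2 where "c\<^sub>1 \<in> X" "z \<in> unit_cube c\<^sub>1" "c\<^sub>2 \<in> Y" "z \<in> unit_cube c\<^sub>2"
      unfolding solid_def by blast
    then show False
      using c disj by blast
  qed
qed

definition brick :: "cube set \<Rightarrow> bool" where
  "brick X \<longleftrightarrow> (\<exists>c c'. share_face c c' \<and> X = {c, c'})"

lemma share_face_sym: "share_face c c' \<Longrightarrow> share_face c' c"
  by (auto simp: share_face_def)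

lemma share_face_neq: "share_face c c' \<Longrightarrow> c \<noteq> c'"
  by (auto simp: share_face_def)

lemma brick_card: "brick X \<Longrightarrow> card X = 2 \<and> finite X"
  by (metis brick_def card_2_iff finite.emptyI finite.insertI share_face_neq)

lemma brick_nonempty: "brick X \<Longrightarrow> X \<noteq> {}"
  by (auto simp: brick_def)

lemma brick_subset_eq: "brick X \<Longrightarrow> brick Y \<Longrightarrow> X \<subseteq> Y \<Longrightarrow> X = Y"
  by (metis brick_card card_subset_eq)

lemma domino_iff: "domino d \<longleftrightarrow> (\<exists>X. brick X \<and> d = solid X)"
proof
  assume "domino d"
  then obtain c c' where "share_face c c'" "d = unit_cube c \<union> unit_cube c'"
    by (auto simp: domino_def)
  then have "brick {c, c'}" "d = solid {c, c'}"
    unfolding brick_def solid_def by blast+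
  then show "\<exists>X. brick X \<and> d = solid X"
    by blast
next
  assume "\<exists>X. brick X \<and> d = solid X"
  then obtain c c' where "share_face c c'" "d = solid {c, c'}"
    by (metis brick_def)
  then have "share_face c c' \<and> d = unit_cube c \<union> unit_cube c'"
    by (simp add: solid_def)
  then show "domino d"
    unfolding domino_def by blast
qed

definition brickings :: "cube set \<Rightarrow> cube set set set" where
  "brickings R = {T. (\<forall>X\<in>T. brick X) \<and> (\<forall>X\<in>T. \<forall>Y\<in>T. X \<noteq> Y \<longrightarrow> X \<inter> Y = {}) \<and> \<Union>T = R}"

text \<open>A tiling is determined by the partition of the set of cubes into bricks, because a solid
  determines its cubes.\<close>

lemma domino_partition_iff:
  "(\<forall>d\<in>t. domino d) \<and> (\<forall>d\<in>t. \<forall>e\<in>t. d \<noteq> e \<longrightarrow> interior d \<inter> interior e = {}) \<and> \<Union>t = solid R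
   \<longleftrightarrow> t \<in> (`) solid ` brickings R"
  (is "?L \<longleftrightarrow> ?R")
proof
  assume L: ?L
  then have "t \<subseteq> range solid"
    by (auto simp: domino_iff)
  then obtain T where T: "t = solid ` T"
    by (meson subset_imageE)
  have "\<forall>X\<in>T. brick X"
    using L by (auto simp: T domino_iff)
  moreover have "\<forall>X\<in>T. \<forall>Y\<in>T. X \<noteq> Y \<longrightarrow> X \<inter> Y = {}"
    using L by (auto simp: T interior_solid_disjoint_iff)
  moreover have "\<Union>T = R"
    using L by (simp add: T flip: solid_Union)
  ultimately show ?R
    by (auto simp: brickings_def T)
next
  assume ?R
  then obtain T where T: "t = solid ` T" "T \<in> brickings R"
    by blast
  then show ?L
    by (auto simp: brickings_def domino_iff interior_solid_disjoint_iff simp flip: solid_Union)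
qed

lemma interval_union_unit:
  assumes "N \<ge> 1" 
  shows "{0..real N} = (\<Union>k\<in>{0..<int N}. {real_of_int k..real_of_int k + 1})"
proof (intro equalityI subsetI)
  fix x assume x: "x \<in> {0..real N}"
  show "x \<in> (\<Union>k\<in>{0..<int N}. {real_of_int k..real_of_int k + 1})"
  proof (cases "x = real N")
    case True
    then show ?thesis
      using assms by (intro UN_I[of "int N - 1"]) auto
  next
    case False
    then have "\<lfloor>x\<rfloor> \<in> {0..<int N}" "real_of_int \<lfloor>x\<rfloor> \<le> x" "x \<le> real_of_int \<lfloor>x\<rfloor> + 1"
      using x by (auto simp: floor_less_iff)
    then show ?thesis
      by (intro UN_I[of "\<lfloor>x\<rfloor>"]) auto
  qed
next
  fix x assume "x \<in> (\<Union>k\<in>{0..<int N}. {real_of_int k..real_of_int k + 1})"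
  then obtain k where "0 \<le> k" "k < int N" "real_of_int k \<le> x" "x \<le> real_of_int k + 1"
    by auto
  then show "x \<in> {0..real N}"
    by auto
qed

locale region =
  fixes D :: "plane set" and S :: "cell set"
  assumes finite_S: "finite S" and S_nonempty: "S \<noteq> {}"
    and D_eq: "D = (\<Union>p\<in>S. unit_square p)"
begin

lemma unit_square_subset_iff: "unit_square p \<subseteq> D \<longleftrightarrow> p \<in> S"
proof
  assume "unit_square p \<subseteq> D"
  moreover have "(of_int (fst p) + 1/2, of_int (snd p) + 1/2) \<in> unit_square p"
    by (auto simp: unit_square_def)
  ultimately obtain q where "q \<in> S" "(of_int (fst p) + 1/2, of_int (snd p) + 1/2) \<in> unit_square q"
    by (auto simp: D_eq)
  moreover from this have "p = q"
    by (auto simp: unit_square_def intro!: int_half_between prod_eqI)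
  ultimately show "p \<in> S"
    by simp
qed (auto simp: D_eq)

lemma cylinder_eq_solid:
  assumes "N \<ge> 1"
  shows "cylinder D N = solid (S \<times> {0..<int N})"
  unfolding cylinder_def interval_union_unit[OF assms] D_eq solid_def
  by (fastforce simp: unit_cube_def)

lemma tilings_eq:
  assumes "N \<ge> 1"
  shows "tilings D N = (`) solid ` brickings (S \<times> {0..<int N})"
  unfolding tilings_def cylinder_eq_solid[OF assms] domino_partition_iff by simp

text \<open>In height \<open>0\<close> the region is flat but nonempty, whereas a domino contains the centres of its
  cubes. The empty walk therefore corresponds to no tiling, which is why nonempty walks are singled
  out below.\<close>

lemma tilings_0: "tilings D 0 = {}"
proof -
  have "t \<notin> tilings D 0" for t
  proof
    assume t: "t \<in> tilings D 0"
    obtain p where "p \<in> S"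
      using S_nonempty by blast
    then have "((of_int (fst p), of_int (snd p)), 0) \<in> cylinder D 0"
      by (auto simp: cylinder_def D_eq unit_square_def intro!: bexI[of _ p])
    then obtain d where "d \<in> t"
      using t by (auto simp: tilings_def)
    then obtain X where X: "brick X" "solid X \<subseteq> cylinder D 0"
      using t by (fastforce simp: tilings_def domino_iff)
    then obtain c where "c \<in> X"
      using brick_nonempty by blast
    then have "centre c \<in> cylinder D 0"
      using X by (meson centre_in_solid subsetD)
    then have "real_of_int (2 * snd c + 1) = real_of_int 0"
      by (simp add: cylinder_def centre_def)
    then have "2 * snd c + 1 = 0"
      by (simp only: of_int_eq_iff)
    then show False
      by presburger
  qed
  then show ?thesis
    by blast
qed

end

section \<open>Tilings as walks on plugs\<close>

definition planar_domino :: "cell set \<Rightarrow> bool" where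
  "planar_domino h \<longleftrightarrow>
     (\<exists>s s'. \<bar>fst s - fst s'\<bar> + \<bar>snd s - snd s'\<bar> = 1 \<and> h = {s, s'})"

definition hbrick :: "int \<Rightarrow> cell set \<Rightarrow> cube set" where
  "hbrick k h = h \<times> {k}"

definition vbrick :: "int \<Rightarrow> cell \<Rightarrow> cube set" where
  "vbrick k s = {s} \<times> {k, k + 1}"

text \<open>A layer \<open>(a, H, b)\<close> describes one floor of a tiling: \<open>H\<close> holds the horizontal dominoes of the
  floor, \<open>a\<close> the cells filled by vertical dominoes coming from the floor below, and \<open>b\<close> the cells
  where vertical dominoes begin that continue into the floor above. The sets \<open>a\<close> and \<open>b\<close> are called
  plugs. Each vertical domino is attributed to the floor in which it begins.\<close>

type_synonym layer = "cell set \<times> cell set set \<times> cell set"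

fun bricks :: "int \<Rightarrow> layer list \<Rightarrow> cube set set" where
  "bricks k [] = {}"
| "bricks k ((a, H, b) # fs) = hbrick k ` H \<union> vbrick k ` b \<union> bricks (k + 1) fs"

text \<open>The mirror image of a stack of floors in a horizontal plane; it represents the inverse in
  the domino group.\<close>

definition reflect :: "layer list \<Rightarrow> layer list" where
  "reflect fs = rev (map (\<lambda>(a, H, b). (b, H, a)) fs)"

definition real_tiling :: "layer list \<Rightarrow> tiling" where
  "real_tiling fs = solid ` bricks 0 fs"

lemma planar_domino_nonempty: "planar_domino h \<Longrightarrow> h \<noteq> {}"
  by (auto simp: planar_domino_def)

lemma brick_hbrick: "planar_domino h \<Longrightarrow> brick (hbrick k h)"
proof -
  assume "planar_domino h"
  then obtain s s' where "\<bar>fst s - fst s'\<bar> + \<bar>snd s - snd s'\<bar> = 1" "h = {s, s'}"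
    unfolding planar_domino_def by blast
  then have "share_face (s, k) (s', k)" "hbrick k h = {(s, k), (s', k)}"
    by (auto simp: share_face_def hbrick_def)
  then show ?thesis
    unfolding brick_def by blast
qed

lemma brick_vbrick: "brick (vbrick k s)"
proof -
  have "share_face (s, k) (s, k + 1)" "vbrick k s = {(s, k), (s, k + 1)}"
    by (auto simp: share_face_def vbrick_def)
  then show ?thesis
    unfolding brick_def by blast
qed

text \<open>The bricks that meet the lowest floor of a region are those recorded by its first layer.\<close>

lemma brick_at_bottom:
  assumes "brick X" "(s, k) \<in> X" "\<And>c. c \<in> X \<Longrightarrow> k \<le> snd c"
  shows "(\<exists>h. planar_domino h \<and> X = hbrick k h \<and> s \<in> h) \<or> X = vbrick k s"
proof -
  obtain c where c: "share_face (s, k) c" "X = {(s, k), c}"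
    using assms(1,2) share_face_sym unfolding brick_def by blast
  then have "k \<le> snd c"
    using assms(3) by auto
  then consider "snd c = k" | "snd c = k + 1" "fst c = s"
  proof (cases "snd c = k")
    case False
    then have "\<bar>fst s - fst (fst c)\<bar> + \<bar>snd s - snd (fst c)\<bar> + \<bar>k - snd c\<bar> = 1" "k < snd c"
      using c(1) \<open>k \<le> snd c\<close> unfolding share_face_def by auto
    then have "snd c = k + 1" "fst (fst c) = fst s" "snd (fst c) = snd s"
      by linarith+
    then show ?thesis
      using that(2) by (simp add: prod_eq_iff)
  qed (use that(1) in simp)
  then show ?thesis
  proof cases
    case 1
    then have "planar_domino {s, fst c}"
      using c(1) unfolding planar_domino_def share_face_def by fastforce
    moreover have "X = hbrick k {s, fst c}"
      using 1 c(2) by (auto simp: hbrick_def)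
    ultimately show ?thesis
      by blast
  next
    case 2
    then have "c = (s, k + 1)"
      by (simp add: prod_eq_iff)
    then have "X = vbrick k s"
      using c(2) by (auto simp: vbrick_def)
    then show ?thesis ..
  qed
qed

lemma hbrick_inject [simp]: "hbrick k h = hbrick k h' \<longleftrightarrow> h = h'"
  by (auto simp: hbrick_def)

lemma vbrick_inject [simp]: "vbrick k s = vbrick k s' \<longleftrightarrow> s = s'"
  by (auto simp: vbrick_def)

lemma hbrick_neq_vbrick [simp]: "hbrick k h \<noteq> vbrick k s" "vbrick k s \<noteq> hbrick k h"
proof -
  have "snd ` hbrick k h \<subseteq> {k}" "snd ` vbrick k s = {k, k + 1}"
    by (auto simp: hbrick_def vbrick_def)
  then show "hbrick k h \<noteq> vbrick k s" "vbrick k s \<noteq> hbrick k h"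
    by force+
qed

lemma bricks_above:
  "X \<in> bricks k fs \<Longrightarrow> c \<in> X \<Longrightarrow> k \<le> snd c"
  by (induction k fs rule: bricks.induct) (fastforce simp: hbrick_def vbrick_def)+

lemma vbrick_notin_bricks_above [simp]: "vbrick k s \<notin> bricks (k + 1) fs"
  using bricks_above[of "vbrick k s" "k + 1" fs "(s, k)"] by (auto simp: vbrick_def)

lemma hbrick_notin_bricks_above: "h \<noteq> {} \<Longrightarrow> hbrick k h \<notin> bricks (k + 1) fs"
  using bricks_above[of "hbrick k h" "k + 1" fs] by (fastforce simp: hbrick_def)

lemma bricks_append: "bricks k (fs @ gs) = bricks k fs \<union> bricks (k + int (length fs)) gs"
  by (induction k fs rule: bricks.induct) (auto simp: algebra_simps)

lemma brickings_Un:
  assumes "T \<in> brickings Q" "T' \<in> brickings R" "Q \<inter> R = {}"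
  shows "T \<union> T' \<in> brickings (Q \<union> R)"
proof -
  have cross: "X \<inter> Y = {}" if "X \<in> T" "Y \<in> T'" for X Y
    using that assms by (auto simp: brickings_def)
  have "X \<inter> Y = {}" if "X \<in> T \<union> T'" "Y \<in> T \<union> T'" "X \<noteq> Y" for X Y
    using that assms(1,2) cross[of X Y] cross[of Y X]
    by (elim UnE) (simp_all add: brickings_def Int_commute)
  then show ?thesis
    using assms(1,2) by (auto simp: brickings_def)
qed

lemma length_reflect [simp]: "length (reflect fs) = length fs"
  by (simp add: reflect_def)

lemma reflect_Nil [simp]: "reflect [] = []"
  by (simp add: reflect_def)

lemma reflect_append [simp]: "reflect (fs @ gs) = reflect gs @ reflect fs"
  by (simp add: reflect_def)

lemma reflect_Cons [simp]: "reflect ((a, H, b) # fs) = reflect fs @ [(b, H, a)]"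
  by (simp add: reflect_def)

lemma reflect_reflect [simp]: "reflect (reflect fs) = fs"
  by (induction fs) auto

context region
begin

definition valid_layer :: "cell set \<Rightarrow> cell set set \<Rightarrow> cell set \<Rightarrow> bool" where
  "valid_layer a H b \<longleftrightarrow> a \<subseteq> S \<and> b \<subseteq> S \<and> a \<inter> b = {} \<and> (\<forall>h\<in>H. planar_domino h) \<and>
     (\<forall>h\<in>H. \<forall>h'\<in>H. h \<noteq> h' \<longrightarrow> h \<inter> h' = {}) \<and> \<Union>H = S - a - b"

fun walk :: "cell set \<Rightarrow> layer list \<Rightarrow> cell set \<Rightarrow> bool" where
  "walk p [] q \<longleftrightarrow> p = q"
| "walk p ((a, H, b) # fs) q \<longleftrightarrow> a = p \<and> valid_layer a H b \<and> walk b fs q"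

abbreviation closed_walk :: "layer list \<Rightarrow> bool" where
  "closed_walk fs \<equiv> walk {} fs {}"

lemma walk_append: "walk p (fs @ gs) r \<longleftrightarrow> (\<exists>q. walk p fs q \<and> walk q gs r)"
  by (induction p fs r rule: walk.induct) auto

lemma valid_layer_sym: "valid_layer a H b \<longleftrightarrow> valid_layer b H a"
  by (auto simp: valid_layer_def)

lemma walk_reflect: "walk p fs q \<Longrightarrow> walk q (reflect fs) p"
  by (induction p fs q rule: walk.induct) (auto simp: walk_append valid_layer_sym)

lemma walk_subset: "walk p fs q \<Longrightarrow> q \<subseteq> S \<Longrightarrow> p \<subseteq> S"
  by (cases fs) (auto simp: valid_layer_def)

lemma walk_functional: "walk p fs q \<Longrightarrow> walk p fs q' \<Longrightarrow> q = q'"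
  by (induction p fs q rule: walk.induct) auto

lemma finite_walks: "finite {fs. walk p fs q \<and> length fs = N}"
proof -
  let ?L = "Pow S \<times> Pow (Pow S) \<times> Pow S"
  have "set fs \<subseteq> ?L" if "walk p fs q" for fs
    using that by (induction p fs q rule: walk.induct) (auto simp: valid_layer_def)
  then have "{fs. walk p fs q \<and> length fs = N} \<subseteq> {fs. set fs \<subseteq> ?L \<and> length fs = N}"
    by blast
  moreover have "finite {fs. set fs \<subseteq> ?L \<and> length fs = N}"
    using finite_S by (intro finite_lists_length_eq) auto
  ultimately show ?thesis
    by (rule finite_subset)
qed

text \<open>The bricks of a walk stick out into the floor above by the final plug \<open>q\<close> and leave out the
  initial plug \<open>p\<close>. The difference is taken last so that both effects cancel for the empty walk.\<close>

lemma bricks_in_brickings: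
  "walk p fs q \<Longrightarrow>
     bricks k fs \<in> brickings ((S \<times> {k..<k + int (length fs)} \<union> q \<times> {k + int (length fs)}) - p \<times> {k})"
proof (induction fs arbitrary: p k)
  case Nil
  then show ?case
    by (auto simp: brickings_def)
next
  case (Cons f fs)
  obtain H b where f: "f = (p, H, b)" and v: "valid_layer p H b" and w: "walk b fs q"
    using Cons.prems by (cases f) auto
  let ?n = "int (length fs)"
  let ?R = "(S \<times> {k + 1..<k + 1 + ?n} \<union> q \<times> {k + 1 + ?n}) - b \<times> {k + 1}"
  have h: "hbrick k ` H \<in> brickings ((S - p - b) \<times> {k})"
  proof -
    have "hbrick k h \<inter> hbrick k h' = {}" if "h \<in> H" "h' \<in> H" "h \<noteq> h'" for h h'
      using v that unfolding valid_layer_def hbrick_def by blast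
    moreover have "\<Union>(hbrick k ` H) = (\<Union>H) \<times> {k}"
      by (auto simp: hbrick_def)
    then have "\<Union>(hbrick k ` H) = (S - p - b) \<times> {k}"
      using v by (simp add: valid_layer_def)
    ultimately show ?thesis
      using v brick_hbrick unfolding brickings_def valid_layer_def by auto
  qed
  have vb: "vbrick k ` b \<in> brickings (b \<times> {k, k + 1})"
    using brick_vbrick unfolding brickings_def by (auto simp: vbrick_def)
  have "hbrick k ` H \<union> vbrick k ` b \<union> bricks (k + 1) fs
      \<in> brickings ((S - p - b) \<times> {k} \<union> b \<times> {k, k + 1} \<union> ?R)"
    using w by (intro brickings_Un h vb Cons.IH) auto
  moreover have "(S - p - b) \<times> {k} \<union> b \<times> {k, k + 1} \<union> ?R =
      (S \<times> {k..<k + int (length (f # fs))} \<union> q \<times> {k + int (length (f # fs))}) - p \<times> {k}"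
    (is "?L = ?R'")
  proof (rule Set.set_eqI)
    fix c :: cube
    obtain s j where c: "c = (s, j)"
      by (cases c)
    have sub: "p \<subseteq> S" "b \<subseteq> S" "p \<inter> b = {}"
      using v by (auto simp: valid_layer_def)
    have last: "b = q" if "?n = 0"
      using w that by simp
    have len: "int (length (f # fs)) = ?n + 1"
      by simp
    have "?n \<ge> 0"
      by simp
    consider "j < k" | "j = k" | "j = k + 1" | "j > k + 1"
      by linarith
    then show "c \<in> ?L \<longleftrightarrow> c \<in> ?R'"
    proof cases
      case 3
      then show ?thesis
        unfolding c len using sub last \<open>?n \<ge> 0\<close> by (cases "?n = 0") auto
    qed (use sub \<open>?n \<ge> 0\<close> in \<open>auto simp: c len\<close>)
  qed
  ultimately show ?case
    by (simp add: f)
qed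

text \<open>Conversely every partition into bricks is read off floor by floor: the bricks meeting the
  lowest floor form the first layer, and the plug on top of it is missing from the region that
  remains. The plug \<open>p\<close> is required to lie inside \<open>S \<times> {k..<k + N}\<close>, which forces it to be empty when
  no floor is left.\<close>

lemma bricks_surj:
  assumes "T \<in> brickings Z" "Z \<inter> p \<times> {k} = {}" "Z \<union> p \<times> {k} = S \<times> {k..<k + int N}"
  shows "\<exists>fs. walk p fs {} \<and> length fs = N \<and> bricks k fs = T"
  using assms
proof (induction N arbitrary: T Z p k)
  case 0
  then have "Z = {}" "p = {}"
    by auto
  then have "T = {}"
    using 0(1) brick_nonempty by (auto simp: brickings_def)
  then show ?case
    using \<open>p = {}\<close> by (intro exI[of _ "[]"]) auto
next
  case (Suc N)
  have brick_T: "brick X" if "X \<in> T" for X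
    using Suc.prems(1) that by (auto simp: brickings_def)
  have disj: "X = Y" if "X \<in> T" "Y \<in> T" "c \<in> X" "c \<in> Y" for X Y c
    using Suc.prems(1) that by (auto simp: brickings_def)
  have UT: "\<Union>T = Z"
    using Suc.prems(1) by (auto simp: brickings_def)
  have Z_sub: "c \<in> S \<times> {k..<k + int (Suc N)}" if "c \<in> Z" for c
    using that unfolding Suc.prems(3)[symmetric] by blast
  have p_sub: "c \<in> S \<times> {k..<k + int (Suc N)}" if "c \<in> p \<times> {k}" for c
    using that unfolding Suc.prems(3)[symmetric] by blast
  have Z_sup: "c \<in> Z" if "c \<in> S \<times> {k..<k + int (Suc N)}" "c \<notin> p \<times> {k}" for c
    using that unfolding Suc.prems(3)[symmetric] by blast
  have above: "k \<le> snd c" if "X \<in> T" "c \<in> X" for X c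
    using that UT Z_sub[of c] by (cases c) auto
  define H where "H = {h. planar_domino h \<and> hbrick k h \<in> T}"
  define b where "b = {s. vbrick k s \<in> T}"
  define T' where "T' = {X \<in> T. \<forall>c\<in>X. k + 1 \<le> snd c}"
  have bottom: "(\<exists>h\<in>H. X = hbrick k h \<and> s \<in> h) \<or> s \<in> b \<and> X = vbrick k s"
    if "X \<in> T" "(s, k) \<in> X" for X s
    using brick_at_bottom[OF brick_T[OF that(1)] that(2) above[OF that(1)]] that(1)
    by (auto simp: H_def b_def)
  have T_split: "T = hbrick k ` H \<union> vbrick k ` b \<union> T'"
  proof (intro equalityI subsetI)
    fix X assume X: "X \<in> T"
    show "X \<in> hbrick k ` H \<union> vbrick k ` b \<union> T'"
    proof (cases "X \<in> T'")
      case False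
      then obtain c where "c \<in> X" "\<not> k + 1 \<le> snd c"
        using X by (auto simp: T'_def)
      then have "c = (fst c, k)"
        using above[OF X, of c] by (simp add: prod_eq_iff)
      then have "(fst c, k) \<in> X"
        using \<open>c \<in> X\<close> by simp
      then show ?thesis
        using bottom[OF X] by blast
    qed auto
  qed (auto simp: H_def b_def T'_def)
  have S_Z: "(s, k) \<in> Z \<longleftrightarrow> s \<in> S - p" for s
    using Z_sub[of "(s, k)"] Z_sup[of "(s, k)"] Suc.prems(2) by auto
  have p_S: "p \<subseteq> S"
    using p_sub by auto
  have b_Z: "(s, k) \<in> Z" "(s, k + 1) \<in> Z" if "s \<in> b" for s
    using that UT by (auto simp: b_def vbrick_def)
  have H_Z: "(s, k) \<in> Z" if "h \<in> H" "s \<in> h" for s h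
    using that UT by (auto simp: H_def hbrick_def)
  have Hb: "s \<notin> b" if "h \<in> H" "s \<in> h" for s h
  proof
    assume "s \<in> b"
    then have "hbrick k h = vbrick k s"
      using that by (intro disj[of _ _ "(s, k)"]) (auto simp: H_def b_def hbrick_def vbrick_def)
    then show False
      by simp
  qed
  have "\<Union>H = S - p - b"
  proof (intro equalityI subsetI)
    fix s assume s: "s \<in> S - p - b"
    then have "(s, k) \<in> \<Union>T"
      using S_Z[of s] UT by blast
    then obtain X where "X \<in> T" "(s, k) \<in> X"
      by blast
    then show "s \<in> \<Union>H"
      using bottom s by blast
  next
    fix s assume "s \<in> \<Union>H"
    then show "s \<in> S - p - b"
      using H_Z Hb S_Z by blast
  qed
  moreover have "h \<inter> h' = {}" if "h \<in> H" "h' \<in> H" "h \<noteq> h'" for h h'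
  proof -
    have "s \<notin> h'" if "s \<in> h" for s
      using disj[of "hbrick k h" "hbrick k h'" "(s, k)"] \<open>h \<in> H\<close> \<open>h' \<in> H\<close> \<open>h \<noteq> h'\<close> that
      by (auto simp: H_def hbrick_def)
    then show ?thesis
      by blast
  qed
  ultimately have v: "valid_layer p H b"
    using p_S b_Z S_Z unfolding valid_layer_def by (auto simp: H_def)
  have T': "T' \<in> brickings (\<Union>T')"
    using Suc.prems(1) by (auto simp: brickings_def T'_def)
  have T'_b: "(s, k + 1) \<notin> X" if "X \<in> T'" "s \<in> b" for X s
    using that disj[of X "vbrick k s" "(s, k + 1)"] by (auto simp: T'_def b_def vbrick_def)
  have "\<Union>T' \<union> b \<times> {k + 1} = S \<times> {k + 1..<k + 1 + int N}"
  proof (intro equalityI subsetI)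
    fix c assume "c \<in> \<Union>T' \<union> b \<times> {k + 1}"
    then have "c \<in> Z" "k + 1 \<le> snd c"
      using UT b_Z by (auto simp: T'_def)
    then show "c \<in> S \<times> {k + 1..<k + 1 + int N}"
      using Z_sub[of c] by (cases c) auto
  next
    fix c assume c: "c \<in> S \<times> {k + 1..<k + 1 + int N}"
    then have "c \<in> Z"
      by (intro Z_sup) auto
    then obtain X where X: "X \<in> T" "c \<in> X"
      using UT by blast
    then show "c \<in> \<Union>T' \<union> b \<times> {k + 1}"
      using c T_split by (cases c) (auto simp: hbrick_def vbrick_def)
  qed
  moreover have "\<Union>T' \<inter> b \<times> {k + 1} = {}"
    using T'_b by blast
  ultimately obtain fs where fs: "walk b fs {}" "length fs = N" "bricks (k + 1) fs = T'"
    using Suc.IH[OF T', of b "k + 1"] by blast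
  show ?case
    using v fs T_split by (intro exI[of _ "(p, H, b) # fs"]) simp
qed

text \<open>The first layer can be recovered because its bricks are exactly those that contain a cube of
  height \<open>k\<close>.\<close>

lemma bricks_inject:
  "walk p fs q \<Longrightarrow> walk p gs q' \<Longrightarrow> length fs = length gs \<Longrightarrow> bricks k fs = bricks k gs \<Longrightarrow> fs = gs"
proof (induction fs arbitrary: p gs k)
  case Nil
  then show ?case
    by simp
next
  case (Cons f fs)
  obtain H b where f: "f = (p, H, b)" "valid_layer p H b" "walk b fs q"
    using Cons.prems by (cases f) auto
  obtain H' b' gs' where g: "gs = (p, H', b') # gs'" "valid_layer p H' b'" "walk b' gs' q'"
    using Cons.prems by (cases gs) auto
  have H: "K = {h. h \<noteq> {} \<and> hbrick k h \<in> bricks k ((p, K, c) # hs)}" and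
       b: "c = {s. vbrick k s \<in> bricks k ((p, K, c) # hs)}" and
       T: "bricks (k + 1) hs = {X \<in> bricks k ((p, K, c) # hs). \<forall>c\<in>X. k + 1 \<le> snd c}"
    if "valid_layer p K c" for K c hs
  proof -
    have ne: "{} \<notin> K"
      using that planar_domino_nonempty[of "{}"] unfolding valid_layer_def by auto
    have mem: "hbrick k h \<in> bricks k ((p, K, c) # hs) \<longleftrightarrow> h \<in> K" if "h \<noteq> {}" for h
      using hbrick_notin_bricks_above[OF that] by (simp add: image_iff)
    show "K = {h. h \<noteq> {} \<and> hbrick k h \<in> bricks k ((p, K, c) # hs)}"
    proof (rule Set.set_eqI)
      fix h
      show "h \<in> K \<longleftrightarrow> h \<in> {h. h \<noteq> {} \<and> hbrick k h \<in> bricks k ((p, K, c) # hs)}"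
        unfolding mem_Collect_eq using ne mem[of h] by (cases "h = {}") (simp_all del: bricks.simps)
    qed
    show "c = {s. vbrick k s \<in> bricks k ((p, K, c) # hs)}"
      by auto
    show "bricks (k + 1) hs = {X \<in> bricks k ((p, K, c) # hs). \<forall>c\<in>X. k + 1 \<le> snd c}"
    proof -
      have "\<exists>c\<in>hbrick k h. \<not> k + 1 \<le> snd c" if "h \<in> K" for h
      proof -
        obtain s where "s \<in> h"
          using ne \<open>h \<in> K\<close> by (metis all_not_in_conv)
        then show ?thesis
          by (intro bexI[of _ "(s, k)"]) (auto simp: hbrick_def)
      qed
      moreover have "\<exists>c\<in>vbrick k s. \<not> k + 1 \<le> snd c" for s
        by (intro bexI[of _ "(s, k)"]) (auto simp: vbrick_def)
      moreover have "\<forall>c\<in>X. k + 1 \<le> snd c" if "X \<in> bricks (k + 1) hs" for X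
        using bricks_above[OF that] by blast
      ultimately show ?thesis
        unfolding bricks.simps by blast
    qed
  qed
  note eq = Cons.prems(4)[unfolded f(1) g(1)]
  have "H = H'"
    using H[OF f(2), of fs] H[OF g(2), of gs'] eq by metis
  moreover have "b = b'"
    using b[OF f(2), of fs] b[OF g(2), of gs'] eq by metis
  moreover have "bricks (k + 1) fs = bricks (k + 1) gs'"
    using T[OF f(2), of fs] T[OF g(2), of gs'] eq by metis
  ultimately show ?case
    using Cons.IH[of b gs' "k + 1"] f g Cons.prems(3) by simp
qed

text \<open>Cutting a tiling by horizontal planes gives a walk: the plug between two consecutive floors
  records the vertical dominoes that cross the plane between them.\<close>

lemma tilings_bij:
  assumes "N \<ge> 1"
  shows "bij_betw real_tiling {fs. closed_walk fs \<and> length fs = N} (tilings D N)"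
proof -
  let ?W = "{fs. closed_walk fs \<and> length fs = N}"
  have "bij_betw (bricks 0) ?W (brickings (S \<times> {0..<int N}))"
  proof (rule bij_betwI')
    fix fs gs assume "fs \<in> ?W" "gs \<in> ?W"
    then show "bricks 0 fs = bricks 0 gs \<longleftrightarrow> fs = gs"
      using bricks_inject by auto
  next
    fix fs assume "fs \<in> ?W"
    then show "bricks 0 fs \<in> brickings (S \<times> {0..<int N})"
      using bricks_in_brickings[of "{}" fs "{}" 0] by simp
  next
    fix T assume "T \<in> brickings (S \<times> {0..<int N})"
    then show "\<exists>fs\<in>?W. T = bricks 0 fs"
      using bricks_surj[of T "S \<times> {0..<int N}" "{}" 0 N] by auto
  qed
  moreover have "bij_betw ((`) solid) (brickings (S \<times> {0..<int N})) (tilings D N)"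
    unfolding tilings_eq[OF assms]
    by (rule inj_on_imp_bij_betw) (simp add: inj_on_def inj_image_eq_iff[OF inj_solid])
  ultimately have "bij_betw ((`) solid \<circ> bricks 0) ?W (tilings D N)"
    by (rule bij_betw_trans)
  moreover have "(`) solid \<circ> bricks 0 = real_tiling"
    by (auto simp: real_tiling_def)
  ultimately show ?thesis
    by simp
qed

end

section \<open>Flips of walks\<close>

definition lift :: "int \<Rightarrow> cube set \<Rightarrow> cube set" where
  "lift k X = (\<lambda>(s, j). (s, j + k)) ` X"

lemma mem_lift [simp]: "(s, j) \<in> lift k X \<longleftrightarrow> (s, j - k) \<in> X"
  by (force simp: lift_def)

lemma lift_inject [simp]: "lift k X = lift k Y \<longleftrightarrow> X = Y"
proof
  assume "lift k X = lift k Y"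
  then have "(s, j) \<in> X \<longleftrightarrow> (s, j) \<in> Y" for s j
    using mem_lift[of s "j + k" k X] mem_lift[of s "j + k" k Y] by simp
  then show "X = Y"
    by auto
qed simp

lemma lift_Un [simp]: "lift k (X \<union> Y) = lift k X \<union> lift k Y"
  by (simp add: lift_def image_Un)

lemma lift_empty [simp]: "lift k {} = {}"
  by (simp add: lift_def)

lemma lift_Int: "lift k X \<inter> lift k Y = lift k (X \<inter> Y)"
  by auto

lemma lift_hbrick [simp]: "lift k (hbrick j h) = hbrick (j + k) h"
  by (auto simp: hbrick_def)

lemma lift_vbrick [simp]: "lift k (vbrick j s) = vbrick (j + k) s"
  by (auto simp: vbrick_def)

lemma brick_lift: "brick X \<Longrightarrow> brick (lift k X)"
proof -
  assume "brick X"
  then obtain c c' where "share_face c c'" "X = {c, c'}"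
    unfolding brick_def by blast
  then have "share_face (fst c, snd c + k) (fst c', snd c' + k)"
      "lift k X = {(fst c, snd c + k), (fst c', snd c' + k)}"
    by (auto simp: share_face_def lift_def case_prod_beta)
  then show ?thesis
    unfolding brick_def by blast
qed

lemma bricks_shift: "bricks (j + k) fs = lift k ` bricks j fs"
proof (induction j fs rule: bricks.induct)
  case (2 j a H b fs)
  have "bricks (j + k + 1) fs = lift k ` bricks (j + 1) fs"
    using 2 by (simp add: algebra_simps)
  then show ?case
    by (simp add: image_Un image_image)
qed simp

lemma unit_cube_shift:
  "unit_cube (s, j + int n) = (\<lambda>x. x + ((0, 0), real n)) ` unit_cube (s, j)"
proof (intro equalityI subsetI)
  fix x assume "x \<in> unit_cube (s, j + int n)"
  then show "x \<in> (\<lambda>x. x + ((0, 0), real n)) ` unit_cube (s, j)"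
    by (intro image_eqI[of _ _ "x - ((0, 0), real n)"])
      (auto simp: unit_cube_def unit_square_def)
qed (auto simp: unit_cube_def unit_square_def)

lemma solid_lift: "solid (lift (int n) X) = (\<lambda>x. x + ((0, 0), real n)) ` solid X"
proof -
  have "unit_cube (case c of (s, j) \<Rightarrow> (s, j + int n)) = (\<lambda>x. x + ((0, 0), real n)) ` unit_cube c" for c
    by (cases c) (simp add: unit_cube_shift)
  then show ?thesis
    by (simp add: solid_def lift_def image_Union image_image)
qed

text \<open>Stacking of tilings is concatenation of walks.\<close>

lemma real_tiling_append:
  "real_tiling (fs @ gs) = stack (length fs) (real_tiling fs) (real_tiling gs)"
  using bricks_shift[of 0 "int (length fs)" gs]
  by (simp add: real_tiling_def bricks_append stack_def image_Un image_image solid_lift)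

lemma flip_block_lift:
  assumes "flip_block (solid X)"
  shows "flip_block (solid (lift (int n) X))"
proof -
  obtain a b c :: int and l m h :: real where
    lmh: "(l, m, h) \<in> {(2, 2, 1), (2, 1, 2), (1, 2, 2)}" and
    X: "solid X = ({real_of_int a..real_of_int a + l} \<times> {real_of_int b..real_of_int b + m})
            \<times> {real_of_int c..real_of_int c + h}"
    using assms unfolding flip_block_def by blast
  have "(\<lambda>x. x + ((0, 0), real n)) ` (A \<times> {real_of_int c..real_of_int c + h}) =
      A \<times> {real_of_int (c + int n)..real_of_int (c + int n) + h}" for A :: "plane set"
  proof (intro equalityI subsetI)
    fix x assume "x \<in> A \<times> {real_of_int (c + int n)..real_of_int (c + int n) + h}"
    then show "x \<in> (\<lambda>x. x + ((0, 0), real n)) ` (A \<times> {real_of_int c..real_of_int c + h})"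
      by (intro image_eqI[of _ _ "x - ((0, 0), real n)"]) (auto simp: zero_prod_def[symmetric])
  qed (auto simp: zero_prod_def[symmetric])
  note shift = this
  show ?thesis
    unfolding flip_block_def solid_lift X shift by (intro exI conjI) (rule lmh, rule refl)
qed

text \<open>Flips expressed through sets of cubes, where translations and overlaps are easy to handle.\<close>

definition brick_flip :: "cube set set \<Rightarrow> cube set set \<Rightarrow> bool" where
  "brick_flip T T' \<longleftrightarrow>
     (\<exists>X\<^sub>0 X\<^sub>1 Y\<^sub>0 Y\<^sub>1. X\<^sub>0 \<in> T \<and> X\<^sub>1 \<in> T \<and> brick Y\<^sub>0 \<and> brick Y\<^sub>1 \<and> Y\<^sub>0 \<inter> Y\<^sub>1 = {} \<and>
        flip_block (solid (X\<^sub>0 \<union> X\<^sub>1)) \<and> Y\<^sub>0 \<union> Y\<^sub>1 = X\<^sub>0 \<union> X\<^sub>1 \<and> {Y\<^sub>0, Y\<^sub>1} \<noteq> {X\<^sub>0, X\<^sub>1} \<and>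
        T' = (T - {X\<^sub>0, X\<^sub>1}) \<union> {Y\<^sub>0, Y\<^sub>1})"

lemma brick_flipI:
  assumes "X\<^sub>0 \<in> T" "X\<^sub>1 \<in> T" "brick Y\<^sub>0" "brick Y\<^sub>1" "Y\<^sub>0 \<inter> Y\<^sub>1 = {}"
    "flip_block (solid (X\<^sub>0 \<union> X\<^sub>1))" "Y\<^sub>0 \<union> Y\<^sub>1 = X\<^sub>0 \<union> X\<^sub>1" "{Y\<^sub>0, Y\<^sub>1} \<noteq> {X\<^sub>0, X\<^sub>1}"
    "T' = (T - {X\<^sub>0, X\<^sub>1}) \<union> {Y\<^sub>0, Y\<^sub>1}"
  shows "brick_flip T T'"
  unfolding brick_flip_def
  by (rule exI[of _ X\<^sub>0], rule exI[of _ X\<^sub>1], rule exI[of _ Y\<^sub>0], rule exI[of _ Y\<^sub>1])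
    (intro conjI assms)

lemma brick_flipE:
  assumes "brick_flip T T'"
  obtains X\<^sub>0 X\<^sub>1 Y\<^sub>0 Y\<^sub>1 where "X\<^sub>0 \<in> T" "X\<^sub>1 \<in> T" "brick Y\<^sub>0" "brick Y\<^sub>1" "Y\<^sub>0 \<inter> Y\<^sub>1 = {}"
    "flip_block (solid (X\<^sub>0 \<union> X\<^sub>1))" "Y\<^sub>0 \<union> Y\<^sub>1 = X\<^sub>0 \<union> X\<^sub>1" "{Y\<^sub>0, Y\<^sub>1} \<noteq> {X\<^sub>0, X\<^sub>1}"
    "T' = (T - {X\<^sub>0, X\<^sub>1}) \<union> {Y\<^sub>0, Y\<^sub>1}"
  using assms unfolding brick_flip_def by (elim exE conjE) (rule that)

lemma flipI:
  assumes "d\<^sub>0 \<in> t" "d\<^sub>1 \<in> t" "domino e\<^sub>0" "domino e\<^sub>1" "interior e\<^sub>0 \<inter> interior e\<^sub>1 = {}"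
    "flip_block (d\<^sub>0 \<union> d\<^sub>1)" "e\<^sub>0 \<union> e\<^sub>1 = d\<^sub>0 \<union> d\<^sub>1" "{e\<^sub>0, e\<^sub>1} \<noteq> {d\<^sub>0, d\<^sub>1}"
    "t' = (t - {d\<^sub>0, d\<^sub>1}) \<union> {e\<^sub>0, e\<^sub>1}"
  shows "flip t t'"
  unfolding flip_def
  by (rule exI[of _ d\<^sub>0], rule exI[of _ d\<^sub>1], rule exI[of _ e\<^sub>0], rule exI[of _ e\<^sub>1])
    (intro conjI assms)

lemma flipE:
  assumes "flip t t'"
  obtains d\<^sub>0 d\<^sub>1 e\<^sub>0 e\<^sub>1 where "d\<^sub>0 \<in> t" "d\<^sub>1 \<in> t" "domino e\<^sub>0" "domino e\<^sub>1"
    "interior e\<^sub>0 \<inter> interior e\<^sub>1 = {}"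
    "flip_block (d\<^sub>0 \<union> d\<^sub>1)" "e\<^sub>0 \<union> e\<^sub>1 = d\<^sub>0 \<union> d\<^sub>1" "{e\<^sub>0, e\<^sub>1} \<noteq> {d\<^sub>0, d\<^sub>1}"
    "t' = (t - {d\<^sub>0, d\<^sub>1}) \<union> {e\<^sub>0, e\<^sub>1}"
  using assms unfolding flip_def by (elim exE conjE) (rule that)

lemma flip_solid_iff: "flip (solid ` T) (solid ` T') \<longleftrightarrow> brick_flip T T'"
proof
  assume "flip (solid ` T) (solid ` T')"
  then obtain d\<^sub>0 d\<^sub>1 e\<^sub>0 e\<^sub>1 where *: "d\<^sub>0 \<in> solid ` T" "d\<^sub>1 \<in> solid ` T" "domino e\<^sub>0" "domino e\<^sub>1"
      "interior e\<^sub>0 \<inter> interior e\<^sub>1 = {}" "flip_block (d\<^sub>0 \<union> d\<^sub>1)" "e\<^sub>0 \<union> e\<^sub>1 = d\<^sub>0 \<union> d\<^sub>1"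
      "{e\<^sub>0, e\<^sub>1} \<noteq> {d\<^sub>0, d\<^sub>1}" "solid ` T' = (solid ` T - {d\<^sub>0, d\<^sub>1}) \<union> {e\<^sub>0, e\<^sub>1}"
    by (rule flipE)
  obtain X\<^sub>0 X\<^sub>1 where X: "X\<^sub>0 \<in> T" "X\<^sub>1 \<in> T" "d\<^sub>0 = solid X\<^sub>0" "d\<^sub>1 = solid X\<^sub>1"
    using *(1,2) by blast
  obtain Y\<^sub>0 Y\<^sub>1 where Y: "brick Y\<^sub>0" "brick Y\<^sub>1" "e\<^sub>0 = solid Y\<^sub>0" "e\<^sub>1 = solid Y\<^sub>1"
    using *(3,4) unfolding domino_iff by blast
  have "solid ` T' = solid ` ((T - {X\<^sub>0, X\<^sub>1}) \<union> {Y\<^sub>0, Y\<^sub>1})"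
    using *(9) unfolding X Y by (simp add: image_set_diff[OF inj_solid])
  then have "T' = (T - {X\<^sub>0, X\<^sub>1}) \<union> {Y\<^sub>0, Y\<^sub>1}"
    by (simp only: inj_image_eq_iff[OF inj_solid])
  moreover have "Y\<^sub>0 \<inter> Y\<^sub>1 = {}" "Y\<^sub>0 \<union> Y\<^sub>1 = X\<^sub>0 \<union> X\<^sub>1" "flip_block (solid (X\<^sub>0 \<union> X\<^sub>1))"
    using *(5,6,7) unfolding X Y interior_solid_disjoint_iff by (simp_all flip: solid_Un)
  moreover have "{Y\<^sub>0, Y\<^sub>1} \<noteq> {X\<^sub>0, X\<^sub>1}"
  proof
    assume "{Y\<^sub>0, Y\<^sub>1} = {X\<^sub>0, X\<^sub>1}"
    then have "solid ` {Y\<^sub>0, Y\<^sub>1} = solid ` {X\<^sub>0, X\<^sub>1}"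
      by simp
    then show False
      using *(8) unfolding X Y by simp
  qed
  ultimately show "brick_flip T T'"
    by (intro brick_flipI[OF X(1,2) Y(1,2)])
next
  assume "brick_flip T T'"
  then obtain X\<^sub>0 X\<^sub>1 Y\<^sub>0 Y\<^sub>1 where *: "X\<^sub>0 \<in> T" "X\<^sub>1 \<in> T" "brick Y\<^sub>0" "brick Y\<^sub>1" "Y\<^sub>0 \<inter> Y\<^sub>1 = {}"
      "flip_block (solid (X\<^sub>0 \<union> X\<^sub>1))" "Y\<^sub>0 \<union> Y\<^sub>1 = X\<^sub>0 \<union> X\<^sub>1" "{Y\<^sub>0, Y\<^sub>1} \<noteq> {X\<^sub>0, X\<^sub>1}"
      "T' = (T - {X\<^sub>0, X\<^sub>1}) \<union> {Y\<^sub>0, Y\<^sub>1}"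
    by (rule brick_flipE)
  have ne: "{solid Y\<^sub>0, solid Y\<^sub>1} \<noteq> {solid X\<^sub>0, solid X\<^sub>1}"
    using *(8) inj_image_eq_iff[OF inj_solid, of "{Y\<^sub>0, Y\<^sub>1}" "{X\<^sub>0, X\<^sub>1}"] by simp
  moreover have "solid ` T' = (solid ` T - {solid X\<^sub>0, solid X\<^sub>1}) \<union> {solid Y\<^sub>0, solid Y\<^sub>1}"
    unfolding *(9) by (simp add: image_set_diff[OF inj_solid])
  moreover have "solid Y\<^sub>0 \<union> solid Y\<^sub>1 = solid X\<^sub>0 \<union> solid X\<^sub>1" "flip_block (solid X\<^sub>0 \<union> solid X\<^sub>1)"
    using *(6,7) by (simp_all flip: solid_Un)
  moreover have "domino (solid Y\<^sub>0)" "domino (solid Y\<^sub>1)"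
    using *(3,4) by (auto simp: domino_iff)
  ultimately show "flip (solid ` T) (solid ` T')"
    using *(1,2,5) ne by (intro flipI[of "solid X\<^sub>0" _ "solid X\<^sub>1" "solid Y\<^sub>0" "solid Y\<^sub>1"])
      (simp_all only: interior_solid_disjoint_iff imageI)
qed

lemma brick_flip_lift:
  assumes "brick_flip T T'"
  shows "brick_flip (lift (int n) ` T) (lift (int n) ` T')"
proof -
  obtain X\<^sub>0 X\<^sub>1 Y\<^sub>0 Y\<^sub>1 where *: "X\<^sub>0 \<in> T" "X\<^sub>1 \<in> T" "brick Y\<^sub>0" "brick Y\<^sub>1" "Y\<^sub>0 \<inter> Y\<^sub>1 = {}"
      "flip_block (solid (X\<^sub>0 \<union> X\<^sub>1))" "Y\<^sub>0 \<union> Y\<^sub>1 = X\<^sub>0 \<union> X\<^sub>1" "{Y\<^sub>0, Y\<^sub>1} \<noteq> {X\<^sub>0, X\<^sub>1}"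
      "T' = (T - {X\<^sub>0, X\<^sub>1}) \<union> {Y\<^sub>0, Y\<^sub>1}"
    using assms by (rule brick_flipE)
  let ?l = "lift (int n)"
  have inj: "inj ?l"
    by (simp add: inj_on_def)
  have "{?l Y\<^sub>0, ?l Y\<^sub>1} \<noteq> {?l X\<^sub>0, ?l X\<^sub>1}"
    using *(8) inj_image_eq_iff[OF inj, of "{Y\<^sub>0, Y\<^sub>1}" "{X\<^sub>0, X\<^sub>1}"] by simp
  moreover have "?l ` T' = (?l ` T - {?l X\<^sub>0, ?l X\<^sub>1}) \<union> {?l Y\<^sub>0, ?l Y\<^sub>1}"
    unfolding *(9) by (simp add: image_set_diff[OF inj])
  moreover have "?l Y\<^sub>0 \<union> ?l Y\<^sub>1 = ?l X\<^sub>0 \<union> ?l X\<^sub>1"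
    using *(7) by (simp flip: lift_Un)
  moreover have "flip_block (solid (?l X\<^sub>0 \<union> ?l X\<^sub>1))"
    using flip_block_lift[OF *(6), of n] by simp
  moreover have "?l Y\<^sub>0 \<inter> ?l Y\<^sub>1 = {}"
    by (simp add: lift_Int *(5))
  ultimately show ?thesis
    by (intro brick_flipI[OF imageI[OF *(1)] imageI[OF *(2)] brick_lift[OF *(3)] brick_lift[OF *(4)]])
qed

lemma brick_flip_Un:
  assumes "brick_flip T T'" "T \<inter> E = {}"
  shows "brick_flip (T \<union> E) (T' \<union> E)"
proof -
  obtain X\<^sub>0 X\<^sub>1 Y\<^sub>0 Y\<^sub>1 where *: "X\<^sub>0 \<in> T" "X\<^sub>1 \<in> T" "brick Y\<^sub>0" "brick Y\<^sub>1" "Y\<^sub>0 \<inter> Y\<^sub>1 = {}"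
      "flip_block (solid (X\<^sub>0 \<union> X\<^sub>1))" "Y\<^sub>0 \<union> Y\<^sub>1 = X\<^sub>0 \<union> X\<^sub>1" "{Y\<^sub>0, Y\<^sub>1} \<noteq> {X\<^sub>0, X\<^sub>1}"
      "T' = (T - {X\<^sub>0, X\<^sub>1}) \<union> {Y\<^sub>0, Y\<^sub>1}"
    using assms(1) by (rule brick_flipE)
  have "X\<^sub>0 \<notin> E" "X\<^sub>1 \<notin> E"
    using *(1,2) assms(2) by blast+
  then have "T' \<union> E = (T \<union> E - {X\<^sub>0, X\<^sub>1}) \<union> {Y\<^sub>0, Y\<^sub>1}"
    unfolding *(9) by blast
  then show ?thesis
    by (intro brick_flipI[OF UnI1[OF *(1)] UnI1[OF *(2)] *(3-8)])
qed

text \<open>In a partition that contains \<open>Y\<^sub>0\<close> and \<open>Y\<^sub>1\<close>, no further brick can lie inside their union. Hence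
  the bricks removed by a flip are not among those that stay.\<close>

lemma pair_exchange_disjoint:
  assumes "\<forall>X\<in>E \<union> {Y\<^sub>0, Y\<^sub>1}. brick X"
    and "\<forall>X\<in>E \<union> {Y\<^sub>0, Y\<^sub>1}. \<forall>Y\<in>E \<union> {Y\<^sub>0, Y\<^sub>1}. X \<noteq> Y \<longrightarrow> X \<inter> Y = {}"
    and "X \<subseteq> Y\<^sub>0 \<union> Y\<^sub>1" "X \<noteq> Y\<^sub>0" "X \<noteq> Y\<^sub>1"
  shows "X \<notin> E"
proof
  assume "X \<in> E"
  then have "X \<inter> Y\<^sub>0 = {}" "X \<inter> Y\<^sub>1 = {}" "X \<noteq> {}"
    using assms(2)[rule_format, of X Y\<^sub>0] assms(2)[rule_format, of X Y\<^sub>1] assms(4,5)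
      assms(1)[rule_format, THEN brick_nonempty, of X] by simp_all
  then show False
    using assms(3) by blast
qed

text \<open>A flip block has four cubes, so the two bricks before and the two bricks after a flip form two
  partitions of the block without a common member; exchanging their roles undoes the flip.\<close>

lemma brick_flip_sym:
  assumes "brick_flip T T'" "T \<in> brickings R" "T' \<in> brickings R"
  shows "brick_flip T' T"
proof -
  obtain X\<^sub>0 X\<^sub>1 Y\<^sub>0 Y\<^sub>1 where *: "X\<^sub>0 \<in> T" "X\<^sub>1 \<in> T" "brick Y\<^sub>0" "brick Y\<^sub>1" "Y\<^sub>0 \<inter> Y\<^sub>1 = {}"
      "flip_block (solid (X\<^sub>0 \<union> X\<^sub>1))" "Y\<^sub>0 \<union> Y\<^sub>1 = X\<^sub>0 \<union> X\<^sub>1" "{Y\<^sub>0, Y\<^sub>1} \<noteq> {X\<^sub>0, X\<^sub>1}"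
      "T' = (T - {X\<^sub>0, X\<^sub>1}) \<union> {Y\<^sub>0, Y\<^sub>1}"
    using assms(1) by (rule brick_flipE)
  have bX: "brick X\<^sub>0" "brick X\<^sub>1" and disj: "\<And>X Y. X \<in> T \<Longrightarrow> Y \<in> T \<Longrightarrow> X \<noteq> Y \<Longrightarrow> X \<inter> Y = {}"
    using *(1,2) assms(2) by (auto simp: brickings_def)
  have "Y\<^sub>0 \<noteq> Y\<^sub>1"
    using *(3,5) brick_nonempty by auto
  have "X\<^sub>0 \<noteq> X\<^sub>1"
  proof
    assume "X\<^sub>0 = X\<^sub>1"
    then have "Y\<^sub>0 = X\<^sub>0" "Y\<^sub>1 = X\<^sub>0"
      using brick_subset_eq[OF *(3) bX(1)] brick_subset_eq[OF *(4) bX(1)] *(7) by auto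
    then show False
      using \<open>Y\<^sub>0 \<noteq> Y\<^sub>1\<close> by simp
  qed
  then have X_disj: "X\<^sub>0 \<inter> X\<^sub>1 = {}"
    using disj *(1,2) by blast
  \<comment> \<open>two partitions of the block into two parts that share one part are equal\<close>
  have same: "Y\<^sub>0 = X\<^sub>0 \<or> Y\<^sub>0 = X\<^sub>1 \<or> Y\<^sub>1 = X\<^sub>0 \<or> Y\<^sub>1 = X\<^sub>1 \<Longrightarrow> {Y\<^sub>0, Y\<^sub>1} = {X\<^sub>0, X\<^sub>1}"
    using X_disj *(5,7) by blast
  have "Y\<^sub>0 \<notin> T - {X\<^sub>0, X\<^sub>1}"
    by (rule pair_exchange_disjoint[of _ X\<^sub>0 X\<^sub>1])
      (use assms(2) *(1,2,7,8) same in \<open>auto simp: brickings_def\<close>)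
  moreover have "Y\<^sub>1 \<notin> T - {X\<^sub>0, X\<^sub>1}"
    by (rule pair_exchange_disjoint[of _ X\<^sub>0 X\<^sub>1])
      (use assms(2) *(1,2,7,8) same in \<open>auto simp: brickings_def\<close>)
  ultimately have "T = (T' - {Y\<^sub>0, Y\<^sub>1}) \<union> {X\<^sub>0, X\<^sub>1}"
    unfolding *(9) using *(1,2) by blast
  moreover have "Y\<^sub>0 \<in> T'" "Y\<^sub>1 \<in> T'" "flip_block (solid (Y\<^sub>0 \<union> Y\<^sub>1))" "X\<^sub>0 \<union> X\<^sub>1 = Y\<^sub>0 \<union> Y\<^sub>1"
      "{X\<^sub>0, X\<^sub>1} \<noteq> {Y\<^sub>0, Y\<^sub>1}"
    using *(6-9) by auto
  ultimately show ?thesis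
    by (intro brick_flipI[of Y\<^sub>0 _ Y\<^sub>1, OF _ _ bX X_disj])
qed

lemma planar_domino_cases:
  assumes "planar_domino h"
  obtains x y where "h = {(x, y), (x + 1, y)}" | x y where "h = {(x, y), (x, y + 1)}"
proof -
  obtain s s' where s: "\<bar>fst s - fst s'\<bar> + \<bar>snd s - snd s'\<bar> = 1" "h = {s, s'}"
    using assms unfolding planar_domino_def by blast
  obtain x y x' y' where c: "s = (x, y)" "s' = (x', y')"
    by (cases s, cases s')
  consider "x' = x + 1 \<and> y' = y" | "x = x' + 1 \<and> y' = y" | "x' = x \<and> y' = y + 1" | "x' = x \<and> y = y' + 1"
    using s(1) unfolding c by simp linarith
  then show ?thesis
    using that s(2) unfolding c by cases (auto simp: insert_commute)
qed

text \<open>The only blocks needed later are those with a vertical direction: a planar domino in two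
  consecutive floors.\<close>

lemma flip_block_square:
  assumes "planar_domino h"
  shows "flip_block (solid (hbrick k h \<union> hbrick (k + 1) h))"
  using assms
proof (cases rule: planar_domino_cases)
  case (1 x y)
  have "solid (hbrick k h \<union> hbrick (k + 1) h) = ({real_of_int x..real_of_int x + 2}
      \<times> {real_of_int y..real_of_int y + 1}) \<times> {real_of_int k..real_of_int k + 2}"
    unfolding 1 by (auto simp: solid_def hbrick_def unit_cube_def unit_square_def)
  then show ?thesis
    unfolding flip_block_def by (intro exI conjI) (rule insertI2[OF insertI1], assumption)
next
  case (2 x y)
  have "solid (hbrick k h \<union> hbrick (k + 1) h) = ({real_of_int x..real_of_int x + 1}
      \<times> {real_of_int y..real_of_int y + 2}) \<times> {real_of_int k..real_of_int k + 2}"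
    unfolding 2 by (auto simp: solid_def hbrick_def unit_cube_def unit_square_def)
  then show ?thesis
    unfolding flip_block_def by (intro exI conjI) (rule insertI2[OF insertI2[OF insertI1]], assumption)
qed

context region
begin

definition walk_flip :: "layer list \<Rightarrow> layer list \<Rightarrow> bool" where
  "walk_flip fs gs \<longleftrightarrow> closed_walk fs \<and> closed_walk gs \<and> length fs = length gs \<and>
     brick_flip (bricks 0 fs) (bricks 0 gs)"

abbreviation walk_conn :: "layer list \<Rightarrow> layer list \<Rightarrow> bool" where
  "walk_conn \<equiv> walk_flip\<^sup>*\<^sup>*"

lemma closed_bricks: "closed_walk fs \<Longrightarrow> bricks 0 fs \<in> brickings (S \<times> {0..<int (length fs)})"
  using bricks_in_brickings[of "{}" fs "{}" 0] by simp

lemma real_tiling_in: "closed_walk fs \<Longrightarrow> fs \<noteq> [] \<Longrightarrow> real_tiling fs \<in> tilings D (length fs)"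
  using tilings_bij[of "length fs"] by (auto simp: bij_betw_def Suc_le_eq)

lemma real_tiling_surj:
  assumes "t \<in> tilings D N"
  obtains fs where "closed_walk fs" "length fs = N" "fs \<noteq> []" "t = real_tiling fs"
proof -
  have "N \<ge> 1"
    using assms tilings_0 by (cases N) auto
  then obtain fs where fs: "closed_walk fs" "length fs = N" "t = real_tiling fs"
    using assms tilings_bij[of N] by (auto simp: bij_betw_def)
  with \<open>N \<ge> 1\<close> show ?thesis
    by (intro that[of fs]) auto
qed

lemma real_tiling_inject:
  "closed_walk fs \<Longrightarrow> closed_walk gs \<Longrightarrow> length fs = length gs \<Longrightarrow> real_tiling fs = real_tiling gs \<Longrightarrow>
     fs = gs"
  unfolding real_tiling_def inj_image_eq_iff[OF inj_solid] by (rule bricks_inject)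

text \<open>A closed walk does not reach into the floors above it, so flips in it do not interfere with
  what is stacked on top.\<close>

lemma bricks_separate:
  assumes "closed_walk u"
  shows "bricks 0 u \<inter> bricks (int (length u)) w = {}"
proof (rule ccontr)
  assume "\<not> ?thesis"
  then obtain X where X: "X \<in> bricks 0 u" "X \<in> bricks (int (length u)) w"
    by blast
  have "brick X" "X \<subseteq> S \<times> {0..<int (length u)}"
    using closed_bricks[OF assms] X(1) unfolding brickings_def by blast+
  then obtain c where c: "c \<in> X" "snd c < int (length u)"
    using brick_nonempty[of X] by fastforce
  show False
    using bricks_above[OF X(2) c(1)] c(2) by simp
qed

lemma walk_flip_sym: "walk_flip fs gs \<Longrightarrow> walk_flip gs fs"
  using brick_flip_sym closed_bricks unfolding walk_flip_def by metis

lemma walk_conn_sym: "walk_conn fs gs \<Longrightarrow> walk_conn gs fs"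
  by (induction rule: rtranclp_induct) (auto intro: converse_rtranclp_into_rtranclp walk_flip_sym)

lemma walk_flip_append_right:
  assumes "walk_flip fs gs" "closed_walk w"
  shows "walk_flip (fs @ w) (gs @ w)"
proof -
  have "brick_flip (bricks 0 fs \<union> bricks (int (length fs)) w) (bricks 0 gs \<union> bricks (int (length fs)) w)"
    using assms(1) bricks_separate[of fs w] by (intro brick_flip_Un) (simp_all add: walk_flip_def)
  then show ?thesis
    using assms by (auto simp: walk_flip_def walk_append bricks_append)
qed

lemma walk_flip_append_left:
  assumes "walk_flip fs gs" "closed_walk u"
  shows "walk_flip (u @ fs) (u @ gs)"
proof -
  let ?n = "int (length u)"
  have "brick_flip (bricks ?n fs) (bricks ?n gs)"
    using brick_flip_lift[of "bricks 0 fs" "bricks 0 gs" "length u"] assms(1)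
      bricks_shift[of 0 ?n fs] bricks_shift[of 0 ?n gs] by (simp add: walk_flip_def)
  then have "brick_flip (bricks ?n fs \<union> bricks 0 u) (bricks ?n gs \<union> bricks 0 u)"
    using bricks_separate[OF assms(2), of fs] by (intro brick_flip_Un) auto
  then show ?thesis
    using assms by (auto simp: walk_flip_def walk_append bricks_append Un_commute)
qed

lemma walk_conn_append:
  assumes "walk_conn fs gs" "closed_walk u" "closed_walk w"
  shows "walk_conn (u @ fs @ w) (u @ gs @ w)"
  using assms(1)
proof (induction rule: rtranclp_induct)
  case (step gs hs)
  have "walk_flip (u @ gs @ w) (u @ hs @ w)"
    by (intro walk_flip_append_left walk_flip_append_right step assms)
  with step.IH show ?case
    by (rule rtranclp.rtrancl_into_rtrancl)
qed simp

lemma walk_conn_length: "walk_conn fs gs \<Longrightarrow> length gs = length fs"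
  by (induction rule: rtranclp_induct) (auto simp: walk_flip_def)

text \<open>Every tiling met on a chain of flips comes from a closed walk, so connectedness by flips can
  be studied on walks.\<close>

lemma flip_connected_iff:
  assumes "closed_walk fs" "fs \<noteq> []" "closed_walk gs" "length gs = length fs"
  shows "flip_connected D (length fs) (real_tiling fs) (real_tiling gs) \<longleftrightarrow> walk_conn fs gs"
proof
  let ?N = "length fs"
  assume "flip_connected D ?N (real_tiling fs) (real_tiling gs)"
  then have "\<exists>hs. real_tiling gs = real_tiling hs \<and> closed_walk hs \<and> length hs = ?N \<and> walk_conn fs hs"
    unfolding flip_connected_def
  proof (induction rule: rtranclp_induct)
    case base
    then show ?case
      using assms by (intro exI[of _ fs]) simp
  next
    case (step t t')
    then obtain hs where hs: "t = real_tiling hs" "closed_walk hs" "length hs = ?N" "walk_conn fs hs"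
      by blast
    obtain hs' where hs': "closed_walk hs'" "length hs' = ?N" "t' = real_tiling hs'"
      using step(2) real_tiling_surj[of t' ?N] by metis
    have "walk_flip hs hs'"
      using step(2) hs hs' by (simp add: walk_flip_def real_tiling_def flip_solid_iff)
    with hs(4) have "walk_conn fs hs'"
      by (rule rtranclp.rtrancl_into_rtrancl)
    then show ?case
      using hs' by (intro exI[of _ hs']) simp
  qed
  then show "walk_conn fs gs"
    using real_tiling_inject assms by metis
next
  assume "walk_conn fs gs"
  then show "flip_connected D (length fs) (real_tiling fs) (real_tiling gs)"
  proof (induction rule: rtranclp_induct)
    case base
    then show ?case
      by (simp add: flip_connected_def)
  next
    case (step gs hs)
    have len: "length gs = length fs" "length hs = length fs" "closed_walk gs" "closed_walk hs"
      using step walk_conn_length by (auto simp: walk_flip_def)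
    then have "gs \<noteq> []" "hs \<noteq> []"
      using assms(2) by auto
    then have "real_tiling gs \<in> tilings D (length fs)" "real_tiling hs \<in> tilings D (length fs)"
      using real_tiling_in[of gs] real_tiling_in[of hs] len by auto
    moreover have "flip (real_tiling gs) (real_tiling hs)"
      using step(2) by (simp add: walk_flip_def real_tiling_def flip_solid_iff)
    ultimately show ?case
      using step.IH unfolding flip_connected_def by (simp add: rtranclp.rtrancl_into_rtrancl)
  qed
qed

section \<open>Local moves\<close>

lemma valid_layer_disjoint:
  "valid_layer a H b \<Longrightarrow> h \<in> H \<Longrightarrow> h' \<in> H \<Longrightarrow> h \<noteq> h' \<Longrightarrow> h \<inter> h' = {}"
  by (simp add: valid_layer_def)

lemma valid_layer_Union: "valid_layer a H b \<Longrightarrow> \<Union>H = S - a - b"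
  by (simp add: valid_layer_def)

lemma valid_layer_disjoint_Union:
  assumes "valid_layer a H b" "M \<subseteq> H" "M' \<subseteq> H" "M \<inter> M' = {}"
  shows "\<Union>M \<inter> \<Union>M' = {}"
proof -
  have "h \<inter> h' = {}" if "h \<in> M" "h' \<in> M'" for h h'
    using that assms by (intro valid_layer_disjoint[OF assms(1)]) auto
  then show ?thesis
    by blast
qed

lemma valid_layer_subset:
  assumes "valid_layer a H b" "M \<subseteq> H" "a' \<subseteq> S" "b' \<subseteq> S" "a' \<inter> b' = {}" "\<Union>M = S - a' - b'"
  shows "valid_layer a' M b'"
proof -
  have "planar_domino h" if "h \<in> M" for h
    using assms(1,2) that by (auto simp: valid_layer_def)
  moreover have "h \<inter> h' = {}" if "h \<in> M" "h' \<in> M" "h \<noteq> h'" for h h'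
    using that assms(2) by (intro valid_layer_disjoint[OF assms(1)]) auto
  ultimately show ?thesis
    using assms(3-6) by (simp add: valid_layer_def)
qed

text \<open>A horizontal domino of a floor may be replaced by two vertical ones starting in its cells.\<close>

lemma valid_layer_open:
  assumes "valid_layer a (insert h H) b" "h \<notin> H"
  shows "valid_layer a H (b \<union> h)"
proof -
  have "h \<inter> \<Union>H = {}"
    using valid_layer_disjoint_Union[OF assms(1), of "{h}" H] assms(2) by auto
  moreover have "h \<union> \<Union>H = S - a - b"
    using valid_layer_Union[OF assms(1)] by simp
  ultimately have "\<Union>H = S - a - (b \<union> h)" "h \<subseteq> S - a - b"
    by blast+
  then show ?thesis
    by (intro valid_layer_subset[OF assms(1)]) (use assms(1) in \<open>auto simp: valid_layer_def\<close>)
qed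

text \<open>The basic move: two equal horizontal dominoes in consecutive floors are replaced by two
  vertical dominoes, so the plug between the floors grows by their two cells.\<close>

lemma square_flip:
  assumes cl: "closed_walk (u @ [(a, insert h H, b), (b, insert h H', c)] @ w)"
    and "h \<notin> H" "h \<notin> H'"
  shows "walk_flip (u @ [(a, insert h H, b), (b, insert h H', c)] @ w)
                   (u @ [(a, H, b \<union> h), (b \<union> h, H', c)] @ w)"
proof -
  let ?fs = "u @ [(a, insert h H, b), (b, insert h H', c)] @ w"
  let ?gs = "u @ [(a, H, b \<union> h), (b \<union> h, H', c)] @ w"
  let ?k = "int (length u)"
  have v: "valid_layer a (insert h H) b" "valid_layer b (insert h H') c"
    using cl by (auto simp: walk_append)
  then have "valid_layer a H (b \<union> h)" "valid_layer (b \<union> h) H' c"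
    using valid_layer_open assms(2,3) valid_layer_sym by metis+
  then have cl': "closed_walk ?gs"
    using cl by (auto simp: walk_append)
  have h: "planar_domino h"
    using v by (auto simp: valid_layer_def)
  then obtain s s' where s: "h = {s, s'}" "s \<noteq> s'"
    unfolding planar_domino_def by fastforce
  define E where "E = bricks 0 u \<union> hbrick ?k ` H \<union> vbrick ?k ` b \<union> hbrick (?k + 1) ` H' \<union>
    vbrick (?k + 1) ` c \<union> bricks (?k + 1 + 1) w"
  let ?X = "hbrick ?k h" and ?X' = "hbrick (?k + 1) h" and ?Y = "vbrick ?k s" and ?Y' = "vbrick ?k s'"
  have fs: "bricks 0 ?fs = E \<union> {?X, ?X'}"
    by (auto simp: bricks_append E_def)
  have gs: "bricks 0 ?gs = E \<union> {?Y, ?Y'}"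
    unfolding s(1) by (auto simp: bricks_append E_def)
  have part: "E \<union> {?Y, ?Y'} \<in> brickings (S \<times> {0..<int (length ?gs)})"
    using closed_bricks[OF cl'] unfolding gs .
  have un: "?Y \<union> ?Y' = ?X \<union> ?X'"
    unfolding s(1) by (auto simp: hbrick_def vbrick_def)
  have "?X \<noteq> ?Y" "?X \<noteq> ?Y'" "?X' \<noteq> ?Y" "?X' \<noteq> ?Y'"
  proof -
    have "snd ` ?X = {?k}" "snd ` ?X' = {?k + 1}" "snd ` ?Y = {?k, ?k + 1}" "snd ` ?Y' = {?k, ?k + 1}"
      unfolding s(1) by (auto simp: hbrick_def vbrick_def)
    then show "?X \<noteq> ?Y" "?X \<noteq> ?Y'" "?X' \<noteq> ?Y" "?X' \<noteq> ?Y'"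
      by force+
  qed
  note ne = this
  have "?X \<notin> E"
    by (rule pair_exchange_disjoint[of _ ?Y ?Y']) (use part un ne in \<open>auto simp: brickings_def\<close>)
  moreover have "?X' \<notin> E"
    by (rule pair_exchange_disjoint[of _ ?Y ?Y']) (use part un ne in \<open>auto simp: brickings_def\<close>)
  ultimately have "E \<union> {?Y, ?Y'} = (E \<union> {?X, ?X'} - {?X, ?X'}) \<union> {?Y, ?Y'}"
    by blast
  moreover have "?Y \<inter> ?Y' = {}"
    using s(2) by (auto simp: vbrick_def)
  moreover have "{?Y, ?Y'} \<noteq> {?X, ?X'}"
    using ne by (metis insertI1 insertE singletonD)
  ultimately have "brick_flip (E \<union> {?X, ?X'}) (E \<union> {?Y, ?Y'})"
    by (intro brick_flipI[of ?X _ ?X' ?Y ?Y'] brick_vbrick flip_block_square h un) auto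
  then show ?thesis
    unfolding walk_flip_def fs gs using cl cl' by simp
qed

text \<open>Two pieces of a walk from plug \<open>p\<close> to plug \<open>q\<close> are equivalent if they may be exchanged by flips
  inside every closed walk. Working in arbitrary surroundings makes this a congruence.\<close>

definition flip_equiv :: "cell set \<Rightarrow> cell set \<Rightarrow> layer list \<Rightarrow> layer list \<Rightarrow> bool" where
  "flip_equiv p q fs gs \<longleftrightarrow>
     (\<forall>u w. walk {} u p \<longrightarrow> walk q w {} \<longrightarrow> walk_conn (u @ fs @ w) (u @ gs @ w))"

lemma flip_equiv_refl [simp]: "flip_equiv p q fs fs"
  by (simp add: flip_equiv_def)

lemma flip_equiv_sym: "flip_equiv p q fs gs \<Longrightarrow> flip_equiv p q gs fs"
  by (simp add: flip_equiv_def walk_conn_sym)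

lemma flip_equiv_trans [trans]:
  "flip_equiv p q fs gs \<Longrightarrow> flip_equiv p q gs hs \<Longrightarrow> flip_equiv p q fs hs"
  unfolding flip_equiv_def by (meson rtranclp_trans)

lemma flip_equiv_append:
  assumes "flip_equiv p q fs gs" "walk p' u p" "walk q w q'"
  shows "flip_equiv p' q' (u @ fs @ w) (u @ gs @ w)"
  unfolding flip_equiv_def
proof (intro allI impI)
  fix u' w' assume "walk {} u' p'" "walk q' w' {}"
  then have "walk {} (u' @ u) p" "walk q (w @ w') {}"
    using assms(2,3) by (auto simp: walk_append)
  then show "walk_conn (u' @ (u @ fs @ w) @ w') (u' @ (u @ gs @ w) @ w')"
    using assms(1) unfolding flip_equiv_def by (metis append.assoc)
qed

lemma square_flip_equiv:
  assumes "valid_layer a (insert h H) b" "valid_layer b (insert h H') c" "h \<notin> H" "h \<notin> H'"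
  shows "flip_equiv a c [(a, insert h H, b), (b, insert h H', c)] [(a, H, b \<union> h), (b \<union> h, H', c)]"
  unfolding flip_equiv_def
  using assms by (auto intro!: r_into_rtranclp[of walk_flip] square_flip[simplified] simp: walk_append)

text \<open>Two floors from \<open>p\<close> back to \<open>p\<close> without horizontal dominoes: cells outside \<open>p\<close> carry a vertical
  domino within the two floors, cells of \<open>p\<close> carry the ends of two vertical dominoes. For \<open>p = {}\<close>
  this is the vertical tiling of height 2.\<close>

definition vpair :: "cell set \<Rightarrow> layer list" where
  "vpair p = [(p, {}, S - p), (S - p, {}, p)]"

definition vpairs :: "nat \<Rightarrow> cell set \<Rightarrow> layer list" where
  "vpairs n p = concat (replicate n (vpair p))"

lemma valid_vertical: "p \<subseteq> S \<Longrightarrow> valid_layer p {} (S - p)"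
  by (auto simp: valid_layer_def)

lemma walk_vpair: "p \<subseteq> S \<Longrightarrow> walk p (vpair p) p"
  using valid_vertical valid_layer_sym by (auto simp: vpair_def)

lemma walk_vpairs: "p \<subseteq> S \<Longrightarrow> walk p (vpairs n p) p"
  using walk_vpair by (induction n) (auto simp: vpairs_def walk_append)

lemma vpairs_0 [simp]: "vpairs 0 p = []"
  by (simp add: vpairs_def)

lemma vpairs_Suc: "vpairs (Suc n) p = vpair p @ vpairs n p"
  by (simp add: vpairs_def)

lemma vpairs_add: "vpairs (m + n) p = vpairs m p @ vpairs n p"
  by (simp add: vpairs_def replicate_add)

lemma length_vpairs [simp]: "length (vpairs n p) = 2 * n"
  by (induction n) (auto simp: vpairs_Suc vpair_def)

lemma valid_layer_finite: "valid_layer p H q \<Longrightarrow> finite H"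
  using finite_S by (intro finite_subset[of H "Pow S"]) (auto simp: valid_layer_def)

lemma valid_layer_part:
  assumes "valid_layer p H q" "M \<subseteq> H"
  shows "valid_layer p M (S - p - \<Union>M)" "valid_layer (p \<union> \<Union>M) (H - M) q"
proof -
  have U: "\<Union>H = S - p - q"
    using assms(1) by (simp add: valid_layer_def)
  then have M: "\<Union>M \<subseteq> S - p - q"
    using assms(2) by blast
  then show "valid_layer p M (S - p - \<Union>M)"
    by (intro valid_layer_subset[OF assms]) (use assms(1) in \<open>auto simp: valid_layer_def\<close>)
  have "\<Union>(H - M) \<inter> \<Union>M = {}"
    using assms(2) by (intro valid_layer_disjoint_Union[OF assms(1)]) auto
  moreover have "\<Union>(H - M) \<union> \<Union>M = S - p - q"
    using U assms(2) by blast
  ultimately have "\<Union>(H - M) = S - (p \<union> \<Union>M) - q"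
    by blast
  then show "valid_layer (p \<union> \<Union>M) (H - M) q"
    by (intro valid_layer_subset[OF assms(1) Diff_subset])
      (use assms(1) M in \<open>auto simp: valid_layer_def\<close>)
qed

text \<open>A horizontal domino above a vertical pair of dominoes is moved below it by two flips: first the
  vertical pair becomes two horizontal dominoes, then the upper two of the three horizontal dominoes
  become vertical. Treating the dominoes of the layer one after another moves the whole layer
  through two vertical floors; \<open>M\<close> is the set of dominoes already moved.\<close>

lemma vertical_passes_layer:
  assumes "valid_layer p H q"
  shows "flip_equiv p q (vpair p @ [(p, H, q)]) ([(p, H, q)] @ vpair q)"
proof -
  let ?st = "\<lambda>M. [(p, M, S - p - \<Union>M), (S - p - \<Union>M, {}, p \<union> \<Union>M), (p \<union> \<Union>M, H - M, q)]"
  have U: "\<Union>H = S - p - q" and sub: "p \<subseteq> S" "q \<subseteq> S" "p \<inter> q = {}"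
    using assms by (auto simp: valid_layer_def)
  have "flip_equiv p q (vpair p @ [(p, H, q)]) (?st M)" if "M \<subseteq> H" for M
    using finite_subset[OF that valid_layer_finite[OF assms]] that
  proof (induction M rule: finite_induct)
    case empty
    then show ?case
      by (simp add: vpair_def)
  next
    case (insert h M)
    then have hM': "h \<in> H" "M \<subseteq> H" "h \<notin> M"
      by auto
    define r where "r = S - p - \<Union>M - h"
    define m where "m = p \<union> \<Union>M"
    define K where "K = H - insert h M"
    have hM: "h \<inter> \<Union>M = {}"
      using valid_layer_disjoint_Union[OF assms, of "{h}" M] hM' by auto
    have hS: "h \<subseteq> S - p - q"
      using U hM'(1) by blast
    have rh: "S - p - \<Union>M = r \<union> h"
      using hM hS unfolding r_def by blast
    have HM: "H - M = insert h K"
      using hM' unfolding K_def by blast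
    have v1: "valid_layer p (insert h M) r"
      using valid_layer_part(1)[OF assms, of "insert h M"] hM'
      by (simp add: r_def Diff_Un Diff_eq Int_ac)
    have v3: "valid_layer m (insert h K) q"
      using valid_layer_part(2)[OF assms hM'(2)] unfolding m_def HM .
    have v2: "valid_layer r {h} m"
    proof (rule valid_layer_subset[OF assms])
      show "\<Union>{h} = S - r - m"
        using hM hS unfolding r_def m_def by blast
    qed (use hM'(1) v1 v3 in \<open>auto simp: valid_layer_def r_def m_def\<close>)
    have "?st M = [] @ [(p, M, r \<union> h), (r \<union> h, {}, m)] @ [(m, insert h K, q)]"
      unfolding rh HM m_def by simp
    also have "flip_equiv p q \<dots> ([] @ [(p, insert h M, r), (r, {h}, m)] @ [(m, insert h K, q)])"
      using v1 v2 v3 hM'(3)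
      by (intro flip_equiv_append[of p m] flip_equiv_sym[OF square_flip_equiv]) auto
    also have "\<dots> = [(p, insert h M, r)] @ [(r, {h}, m), (m, insert h K, q)] @ []"
      by simp
    also have "flip_equiv p q \<dots> ([(p, insert h M, r)] @ [(r, {}, m \<union> h), (m \<union> h, K, q)] @ [])"
      using v1 v2 v3
      by (intro flip_equiv_append[of r q] square_flip_equiv) (auto simp: K_def)
    also have "\<dots> = ?st (insert h M)"
      by (auto simp: r_def m_def K_def)
    finally show ?case
      by (rule flip_equiv_trans[OF insert.IH[OF hM'(2)]])
  qed
  from this[OF subset_refl] have "flip_equiv p q (vpair p @ [(p, H, q)]) (?st H)" .
  also have "?st H = [(p, H, q)] @ vpair q"
  proof -
    have "S - p - \<Union>H = q" "p \<union> \<Union>H = S - q"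
      using U sub by blast+
    then show ?thesis
      by (simp add: vpair_def)
  qed
  finally show ?thesis .
qed

text \<open>In a layer followed by its mirror image every horizontal domino occurs twice, one above the
  other, and all these pairs can be flipped into vertical position.\<close>

lemma layer_reflect_equiv:
  assumes "valid_layer p H q"
  shows "flip_equiv p p [(p, H, q), (q, H, p)] (vpair p)"
proof -
  let ?st = "\<lambda>M. [(p, H - M, q \<union> \<Union>M), (q \<union> \<Union>M, H - M, p)]"
  have U: "\<Union>H = S - p - q" and sub: "p \<subseteq> S" "q \<subseteq> S" "p \<inter> q = {}"
    using assms by (auto simp: valid_layer_def)
  have "flip_equiv p p [(p, H, q), (q, H, p)] (?st M)" if "M \<subseteq> H" for M
    using finite_subset[OF that valid_layer_finite[OF assms]] that
  proof (induction M rule: finite_induct)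
    case empty
    then show ?case
      by simp
  next
    case (insert h M)
    then have hM': "h \<in> H" "M \<subseteq> H" "h \<notin> M"
      by auto
    define K where "K = H - insert h M"
    have HM: "H - M = insert h K"
      using hM' unfolding K_def by blast
    have v: "valid_layer (q \<union> \<Union>M) (insert h K) p"
      using valid_layer_part(2)[OF assms[unfolded valid_layer_sym[of p]] hM'(2)] unfolding HM .
    have "flip_equiv p p (?st M) [(p, K, (q \<union> \<Union>M) \<union> h), ((q \<union> \<Union>M) \<union> h, K, p)]"
      unfolding HM using v valid_layer_sym by (intro square_flip_equiv) (auto simp: K_def)
    also have "(q \<union> \<Union>M) \<union> h = q \<union> \<Union>(insert h M)"
      by blast
    finally show ?case
      unfolding K_def by (rule flip_equiv_trans[OF insert.IH[OF hM'(2)]])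
  qed
  from this[OF subset_refl] have "flip_equiv p p [(p, H, q), (q, H, p)] (?st H)" .
  also have "?st H = vpair p"
  proof -
    have "q \<union> \<Union>H = S - p"
      using U sub by blast
    then show ?thesis
      by (simp add: vpair_def)
  qed
  finally show ?thesis .
qed

lemma vertical_passes_walk:
  assumes "walk p fs q" "q \<subseteq> S"
  shows "flip_equiv p q (vpair p @ fs) (fs @ vpair q)"
  using assms
proof (induction fs arbitrary: p)
  case Nil
  then show ?case
    by simp
next
  case (Cons f fs)
  obtain H b where f: "f = (p, H, b)" "valid_layer p H b" "walk b fs q"
    using Cons.prems by (cases f) auto
  have "vpair p @ f # fs = [] @ (vpair p @ [(p, H, b)]) @ fs"
    by (simp add: f(1))
  also have "flip_equiv p q \<dots> ([] @ ([(p, H, b)] @ vpair b) @ fs)"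
    using f by (intro flip_equiv_append[of p b] vertical_passes_layer) auto
  also have "\<dots> = [(p, H, b)] @ (vpair b @ fs) @ []"
    by simp
  also have "flip_equiv p q \<dots> ([(p, H, b)] @ (fs @ vpair q) @ [])"
    using f Cons by (intro flip_equiv_append[of b q] Cons.IH) auto
  finally show ?case
    by (simp add: f(1))
qed

lemma verticals_pass_walk:
  assumes "walk p fs q" "q \<subseteq> S"
  shows "flip_equiv p q (vpairs n p @ fs) (fs @ vpairs n q)"
proof (induction n)
  case 0
  then show ?case
    by simp
next
  case (Suc n)
  have p: "p \<subseteq> S"
    using walk_subset assms by blast
  have "vpairs (Suc n) p @ fs = vpair p @ (vpairs n p @ fs) @ []"
    by (simp add: vpairs_Suc)
  also have "flip_equiv p q \<dots> (vpair p @ (fs @ vpairs n q) @ [])"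
    by (intro flip_equiv_append[OF Suc] walk_vpair p) simp
  also have "\<dots> = [] @ (vpair p @ fs) @ vpairs n q"
    by simp
  also have "flip_equiv p q \<dots> ([] @ (fs @ vpair q) @ vpairs n q)"
    by (intro flip_equiv_append[OF vertical_passes_walk] assms walk_vpairs) simp
  finally show ?case
    by (simp add: vpairs_Suc)
qed

text \<open>A walk followed by its mirror image is equivalent to vertical floors: the innermost layer and
  its mirror image become vertical, and these vertical floors are moved out of the way before the
  next layer is treated. This is the inverse law of the domino group, and it holds between
  arbitrary plugs.\<close>

lemma walk_reflect_equiv:
  assumes "walk p fs q" "q \<subseteq> S"
  shows "flip_equiv p p (fs @ reflect fs) (vpairs (length fs) p)"
  using assms
proof (induction fs arbitrary: p)
  case Nil
  then show ?case
    by simp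
next
  case (Cons f fs)
  obtain H b where f: "f = (p, H, b)" "valid_layer p H b" "walk b fs q"
    using Cons.prems by (cases f) auto
  let ?n = "length fs"
  have sub: "p \<subseteq> S" "b \<subseteq> S"
    using f(2) by (auto simp: valid_layer_def)
  have f': "walk p [(p, H, b)] b" "walk b [(b, H, p)] p"
    using f(2) valid_layer_sym by auto
  have "(f # fs) @ reflect (f # fs) = [(p, H, b)] @ (fs @ reflect fs) @ [(b, H, p)]"
    by (simp add: f(1))
  also have "flip_equiv p p \<dots> ([(p, H, b)] @ vpairs ?n b @ [(b, H, p)])"
    by (intro flip_equiv_append[OF Cons.IH] f' f(3) Cons.prems(2))
  also have "\<dots> = [(p, H, b)] @ (vpairs ?n b @ [(b, H, p)]) @ []"
    by simp
  also have "flip_equiv p p \<dots> ([(p, H, b)] @ ([(b, H, p)] @ vpairs ?n p) @ [])"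
    by (intro flip_equiv_append[OF verticals_pass_walk] f' sub) simp
  also have "\<dots> = [] @ [(p, H, b), (b, H, p)] @ vpairs ?n p"
    by simp
  also have "flip_equiv p p \<dots> ([] @ vpair p @ vpairs ?n p)"
    by (intro flip_equiv_append[OF layer_reflect_equiv] f(2) walk_vpairs sub) simp
  finally show ?case
    by (simp add: vpairs_Suc)
qed

end

section \<open>The domino group in terms of closed walks\<close>

context region
begin

abbreviation verticals :: "nat \<Rightarrow> layer list" where
  "verticals n \<equiv> vpairs n {}"

lemma closed_verticals [simp]: "closed_walk (verticals n)"
  by (simp add: walk_vpairs)

lemma closed_append: "closed_walk fs \<Longrightarrow> closed_walk gs \<Longrightarrow> closed_walk (fs @ gs)"
  by (auto simp: walk_append)

text \<open>The relation that defines the domino group. The two amounts of vertical padding are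
  independent here; equality of the total heights is enforced by the flips.\<close>

definition sim :: "layer list \<Rightarrow> layer list \<Rightarrow> bool" where
  "sim fs gs \<longleftrightarrow> closed_walk fs \<and> closed_walk gs \<and>
     (\<exists>j k. walk_conn (fs @ verticals j) (gs @ verticals k))"

lemma sim_closed: "sim fs gs \<Longrightarrow> closed_walk fs" "sim fs gs \<Longrightarrow> closed_walk gs"
  by (simp_all add: sim_def)

lemma sim_refl: "closed_walk fs \<Longrightarrow> sim fs fs"
  by (auto simp: sim_def)

lemma sim_sym: "sim fs gs \<Longrightarrow> sim gs fs"
  unfolding sim_def using walk_conn_sym by blast

lemma walk_conn_verticals:
  "walk_conn (fs @ verticals j) (gs @ verticals k) \<Longrightarrow>
     walk_conn (fs @ verticals (j + l)) (gs @ verticals (k + l))"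
  using walk_conn_append[of _ _ "[]" "verticals l"] by (force simp: vpairs_add)

lemma sim_trans:
  assumes "sim fs gs" "sim gs hs"
  shows "sim fs hs"
proof -
  obtain j k k' l where "walk_conn (fs @ verticals j) (gs @ verticals k)"
      "walk_conn (gs @ verticals k') (hs @ verticals l)"
    using assms by (auto simp: sim_def)
  then have "walk_conn (fs @ verticals (j + k')) (gs @ verticals (k + k'))"
      "walk_conn (gs @ verticals (k' + k)) (hs @ verticals (l + k))"
    by (auto intro: walk_conn_verticals)
  then have "walk_conn (fs @ verticals (j + k')) (hs @ verticals (l + k))"
    by (simp add: add.commute[of k k'])
  then show ?thesis
    using assms by (auto simp: sim_def)
qed

lemma flip_equiv_closed:
  assumes "flip_equiv p q fs gs" "walk {} u p" "walk q w {}"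
  shows "walk_conn (u @ fs @ w) (u @ gs @ w)"
  using assms by (simp add: flip_equiv_def)

text \<open>The padding that follows \<open>fs\<close> has to be moved behind \<open>fs'\<close>; this is possible because vertical
  floors pass every walk.\<close>

lemma sim_append:
  assumes "sim fs gs" "sim fs' gs'"
  shows "sim (fs @ fs') (gs @ gs')"
proof -
  note cl = sim_closed[OF assms(1)] sim_closed[OF assms(2)]
  obtain j k j' k' where c: "walk_conn (fs @ verticals j) (gs @ verticals k)"
      "walk_conn (fs' @ verticals j') (gs' @ verticals k')"
    using assms by (auto simp: sim_def)
  have pass: "walk_conn (as @ verticals i @ bs @ ws) (as @ bs @ verticals i @ ws)"
    if "closed_walk as" "closed_walk bs" "closed_walk ws" for as bs ws i
    using flip_equiv_closed[OF verticals_pass_walk[OF that(2)] that(1,3), of i] by simp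
  have "walk_conn (fs @ fs' @ verticals j @ verticals j') (fs @ verticals j @ fs' @ verticals j')"
    by (intro walk_conn_sym[OF pass] cl closed_verticals)
  also have "walk_conn \<dots> (gs @ verticals k @ fs' @ verticals j')"
    using walk_conn_append[OF c(1), of "[]" "fs' @ verticals j'"] cl closed_append by simp
  also have "walk_conn \<dots> (gs @ verticals k @ gs' @ verticals k')"
    using walk_conn_append[OF c(2), of "gs @ verticals k" "[]"] cl closed_append by simp
  also have "walk_conn \<dots> (gs @ gs' @ verticals k @ verticals k')"
    by (intro pass cl closed_verticals)
  finally have "walk_conn ((fs @ fs') @ verticals (j + j')) ((gs @ gs') @ verticals (k + k'))"
    by (simp add: vpairs_add)
  then show ?thesis
    using cl closed_append unfolding sim_def by blast
qed

lemma sim_verticals: "closed_walk fs \<Longrightarrow> sim (fs @ verticals n) fs"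
proof -
  assume cl: "closed_walk fs"
  have "walk_conn ((fs @ verticals n) @ verticals 0) (fs @ verticals n)"
    by simp
  then show ?thesis
    using cl closed_append closed_verticals unfolding sim_def by blast
qed

text \<open>Detours of the form \<open>s @ reflect s\<close> may be removed at any plug, not only between closed walks.
  This allows a group element to be attached to a walk between two arbitrary plugs.\<close>

lemma sim_cancel:
  assumes "walk {} u p" "walk p s q" "q \<subseteq> S" "walk p w {}"
  shows "sim (u @ s @ reflect s @ w) (u @ w)"
proof -
  let ?n = "length s"
  have "walk_conn (u @ (s @ reflect s) @ w) (u @ vpairs ?n p @ w)"
    by (rule flip_equiv_closed[OF walk_reflect_equiv[OF assms(2,3)] assms(1,4)])
  moreover have "walk_conn (u @ (vpairs ?n p @ w) @ []) (u @ (w @ verticals ?n) @ [])"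
    using assms by (intro flip_equiv_closed[OF verticals_pass_walk]) auto
  ultimately have "walk_conn ((u @ s @ reflect s @ w) @ verticals 0) ((u @ w) @ verticals ?n)"
    by simp
  moreover have "closed_walk (u @ s @ reflect s @ w)" "closed_walk (u @ w)"
    using assms walk_reflect[OF assms(2)] by (auto simp: walk_append)
  ultimately show ?thesis
    unfolding sim_def by blast
qed

lemma sim_length: "sim fs gs \<Longrightarrow> length fs mod 2 = length gs mod 2"
proof -
  assume "sim fs gs"
  then obtain j k where "walk_conn (fs @ verticals j) (gs @ verticals k)"
    by (auto simp: sim_def)
  then have "length gs + 2 * k = length fs + 2 * j"
    using walk_conn_length by fastforce
  then show ?thesis
    by presburger
qed

lemma bricks_verticals: "bricks k (verticals n) = {vbrick (k + 2 * int i) p | p i. p \<in> S \<and> i < n}"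
proof (induction n arbitrary: k)
  case (Suc n)
  have "bricks k (verticals (Suc n)) = vbrick k ` S \<union> bricks (k + 2) (verticals n)"
    by (simp add: vpairs_Suc vpair_def add.commute)
  also have "\<dots> = {vbrick (k + 2 * int i) p | p i. p \<in> S \<and> i < Suc n}"
    unfolding Suc
  proof (intro equalityI subsetI)
    fix X assume "X \<in> vbrick k ` S \<union> {vbrick (k + 2 + 2 * int i) p | p i. p \<in> S \<and> i < n}"
    then consider p where "X = vbrick (k + 2 * int 0) p" "p \<in> S"
      | p i where "X = vbrick (k + 2 * int (Suc i)) p" "p \<in> S" "i < n"
      by (auto simp: algebra_simps)
    then show "X \<in> {vbrick (k + 2 * int i) p | p i. p \<in> S \<and> i < Suc n}"
      by cases blast+
  next
    fix X assume "X \<in> {vbrick (k + 2 * int i) p | p i. p \<in> S \<and> i < Suc n}"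
    then obtain p i where X: "X = vbrick (k + 2 * int i) p" "p \<in> S" "i < Suc n"
      by blast
    show "X \<in> vbrick k ` S \<union> {vbrick (k + 2 + 2 * int i) p | p i. p \<in> S \<and> i < n}"
    proof (cases i)
      case (Suc i')
      then have "X = vbrick (k + 2 + 2 * int i') p" "i' < n"
        using X by (auto simp: algebra_simps)
      then show ?thesis
        using X(2) by blast
    qed (use X in simp)
  qed
  finally show ?case .
qed simp

lemma vertical_tiling_eq: "vertical_tiling D (2 * n) = real_tiling (verticals n)"
proof -
  have sol: "unit_cube (p, j) \<union> unit_cube (p, j + 1) = solid (vbrick j p)" for j p
    by (auto simp: solid_def vbrick_def)
  have less: "2 * k + 1 < 2 * n \<longleftrightarrow> k < n" for k
    by presburger
  have image: "f ` {g p i | p i. p \<in> S \<and> i < n} = {f (g p i) | p i. p \<in> S \<and> i < n}"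
    for f :: "cube set \<Rightarrow> space set" and g :: "cell \<Rightarrow> nat \<Rightarrow> cube set"
    by blast
  show ?thesis
    unfolding vertical_tiling_def real_tiling_def bricks_verticals unit_square_subset_iff sol less
      image add_0 ..
qed

lemma domino_rel_iff:
  assumes "closed_walk fs" "fs \<noteq> []" "closed_walk gs" "gs \<noteq> []"
  shows "((length fs, real_tiling fs), (length gs, real_tiling gs)) \<in> domino_rel D \<longleftrightarrow> sim fs gs"
proof -
  have mem: "(length fs, real_tiling fs) \<in> all_tilings D" "(length gs, real_tiling gs) \<in> all_tilings D"
    using real_tiling_in assms by (auto simp: all_tilings_def)
  have st: "stack (length hs) (real_tiling hs) (vertical_tiling D (2 * j)) = real_tiling (hs @ verticals j)"
    for hs j
    by (simp add: vertical_tiling_eq real_tiling_append)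
  have conn: "flip_connected D (length fs + 2 * j) (real_tiling (fs @ verticals j))
        (real_tiling (gs @ verticals k)) \<longleftrightarrow> walk_conn (fs @ verticals j) (gs @ verticals k)"
    if "length fs + 2 * j = length gs + 2 * k" for j k
    using flip_connected_iff[of "fs @ verticals j" "gs @ verticals k"] that assms closed_append
    by simp
  show ?thesis
  proof
    assume "((length fs, real_tiling fs), (length gs, real_tiling gs)) \<in> domino_rel D"
    then obtain N where N: "length fs mod 2 = length gs mod 2" "N mod 2 = length fs mod 2"
        "max (length fs) (length gs) \<le> N"
        "flip_connected D N (stack (length fs) (real_tiling fs) (vertical_tiling D (N - length fs)))
                            (stack (length gs) (real_tiling gs) (vertical_tiling D (N - length gs)))"
      by (auto simp: domino_rel_def)
    define j where "j = (N - length fs) div 2"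
    define k where "k = (N - length gs) div 2"
    have "N - l = 2 * ((N - l) div 2)" if "l mod 2 = N mod 2" "l \<le> N" for l
      using that by presburger
    then have jk: "N - length fs = 2 * j" "N - length gs = 2 * k"
      using N(1-3) unfolding j_def k_def by simp_all
    then have "N = length fs + 2 * j" "length fs + 2 * j = length gs + 2 * k"
      using N(3) by auto
    then have "walk_conn (fs @ verticals j) (gs @ verticals k)"
      using N(4) conn unfolding jk st by simp
    then show "sim fs gs"
      using assms unfolding sim_def by blast
  next
    assume s: "sim fs gs"
    then obtain j k where jk: "walk_conn (fs @ verticals j) (gs @ verticals k)"
      by (auto simp: sim_def)
    have len: "length fs + 2 * j = length gs + 2 * k"
      using walk_conn_length[OF jk] by simp
    let ?N = "length fs + 2 * j"
    have "?N - length fs = 2 * j" "?N - length gs = 2 * k"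
      using len by auto
    then have "flip_connected D ?N (stack (length fs) (real_tiling fs) (vertical_tiling D (?N - length fs)))
                            (stack (length gs) (real_tiling gs) (vertical_tiling D (?N - length gs)))"
      using jk conn[OF len] by (simp only: st)
    moreover have "?N mod 2 = length fs mod 2"
      by simp
    moreover have "max (length fs) (length gs) \<le> ?N"
      using len by linarith
    ultimately show "((length fs, real_tiling fs), (length gs, real_tiling gs)) \<in> domino_rel D"
      unfolding domino_rel_def using mem sim_length[OF s] by blast
  qed
qed

text \<open>The class of a closed walk in the domino group. Only nonempty members are listed, since the
  empty walk represents no tiling, but \<open>cls []\<close> itself is meaningful: it is the identity.\<close>

definition cls :: "layer list \<Rightarrow> (nat \<times> tiling) set" where
  "cls fs = {(length gs, real_tiling gs) | gs. gs \<noteq> [] \<and> sim fs gs}"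

lemma domino_class_eq:
  assumes "closed_walk fs" "fs \<noteq> []"
  shows "domino_class D (length fs) (real_tiling fs) = cls fs"
proof (intro equalityI subsetI)
  fix x assume x: "x \<in> domino_class D (length fs) (real_tiling fs)"
  then have "x \<in> all_tilings D"
    by (auto simp: domino_class_def domino_rel_def)
  then obtain gs where gs: "closed_walk gs" "gs \<noteq> []" "x = (length gs, real_tiling gs)"
    using real_tiling_surj by (auto simp: all_tilings_def) metis
  then have "sim fs gs"
    using x domino_rel_iff[OF assms gs(1,2)] by (simp add: domino_class_def)
  then show "x \<in> cls fs"
    using gs by (auto simp: cls_def)
next
  fix x assume "x \<in> cls fs"
  then obtain gs where gs: "gs \<noteq> []" "sim fs gs" "x = (length gs, real_tiling gs)"
    by (auto simp: cls_def)
  then show "x \<in> domino_class D (length fs) (real_tiling fs)"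
    using domino_rel_iff[OF assms sim_closed(2)[OF gs(2)] gs(1)] by (simp add: domino_class_def)
qed

lemma cls_eqI: "sim fs gs \<Longrightarrow> cls fs = cls gs"
  unfolding cls_def using sim_trans sim_sym by blast

lemma cls_verticals: "closed_walk fs \<Longrightarrow> cls (fs @ verticals n) = cls fs"
  by (intro cls_eqI sim_verticals)

lemma cls_cancel:
  "walk {} u p \<Longrightarrow> walk p s q \<Longrightarrow> q \<subseteq> S \<Longrightarrow> walk p w {} \<Longrightarrow>
     cls (u @ s @ reflect s @ w) = cls (u @ w)"
  by (intro cls_eqI sim_cancel)

lemma cls_nonempty_rep:
  assumes "closed_walk fs"
  obtains gs where "closed_walk gs" "gs \<noteq> []" "cls fs = cls gs" "sim fs gs"
proof (rule that)
  show "closed_walk (fs @ verticals 1)"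
    using assms closed_append by simp
  show "fs @ verticals 1 \<noteq> []"
    by (simp add: vpairs_Suc vpair_def)
  show "cls fs = cls (fs @ verticals 1)"
    using cls_verticals[OF assms] by simp
  show "sim fs (fs @ verticals 1)"
    using sim_verticals[OF assms] by (rule sim_sym)
qed

abbreviation "G \<equiv> domino_group D"

lemma carrier_eq: "carrier G = cls ` {fs. closed_walk fs}"
proof (intro equalityI subsetI)
  fix X assume "X \<in> carrier G"
  then obtain N t where t: "t \<in> tilings D N" "X = domino_class D N t"
    by (auto simp: domino_group_def quotient_def all_tilings_def domino_class_def)
  then obtain fs where "closed_walk fs" "length fs = N" "fs \<noteq> []" "t = real_tiling fs"
    using real_tiling_surj by metis
  then show "X \<in> cls ` {fs. closed_walk fs}"
    using t domino_class_eq by auto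
next
  fix X assume "X \<in> cls ` {fs. closed_walk fs}"
  then obtain fs' where fs': "closed_walk fs'" "X = cls fs'"
    by blast
  obtain fs where fs: "closed_walk fs" "fs \<noteq> []" "X = cls fs"
    by (rule cls_nonempty_rep[OF fs'(1)]) (simp add: fs'(2))
  then have "X = domino_rel D `` {(length fs, real_tiling fs)}"
    using domino_class_eq by (simp add: domino_class_def)
  moreover have "(length fs, real_tiling fs) \<in> all_tilings D"
    using real_tiling_in fs by (simp add: all_tilings_def)
  ultimately show "X \<in> carrier G"
    by (auto simp: domino_group_def quotient_def)
qed

lemma cls_in_carrier [simp]: "closed_walk fs \<Longrightarrow> cls fs \<in> carrier G"
  by (simp add: carrier_eq)

lemma one_eq: "\<one>\<^bsub>G\<^esub> = cls []"
proof -
  have "\<one>\<^bsub>G\<^esub> = domino_class D (length (verticals 1)) (real_tiling (verticals 1))"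
    using vertical_tiling_eq[of 1] by (simp add: domino_group_def)
  also have "\<dots> = cls (verticals 1)"
    by (rule domino_class_eq[OF closed_verticals]) (simp add: vpairs_Suc vpair_def)
  also have "\<dots> = cls []"
    using cls_verticals[of "[]" 1] by simp
  finally show ?thesis .
qed

text \<open>The product is defined through all pairs of representatives; they all yield the same class
  by compatibility of \<open>sim\<close> with concatenation.\<close>

lemma cls_append:
  assumes "closed_walk fs" "closed_walk gs"
  shows "cls (fs @ gs) = cls fs \<otimes>\<^bsub>G\<^esub> cls gs"
proof -
  have const: "domino_class D (N\<^sub>0 + N\<^sub>1) (stack N\<^sub>0 t\<^sub>0 t\<^sub>1) = cls (fs @ gs)"
    if mem: "(N\<^sub>0, t\<^sub>0) \<in> cls fs" "(N\<^sub>1, t\<^sub>1) \<in> cls gs" for N\<^sub>0 N\<^sub>1 t\<^sub>0 t\<^sub>1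
  proof -
    obtain fs' where fs': "N\<^sub>0 = length fs'" "t\<^sub>0 = real_tiling fs'" "fs' \<noteq> []" "sim fs fs'"
      using mem(1) unfolding cls_def by blast
    obtain gs' where gs': "N\<^sub>1 = length gs'" "t\<^sub>1 = real_tiling gs'" "gs' \<noteq> []" "sim gs gs'"
      using mem(2) unfolding cls_def by blast
    have "domino_class D (N\<^sub>0 + N\<^sub>1) (stack N\<^sub>0 t\<^sub>0 t\<^sub>1) =
        domino_class D (length (fs' @ gs')) (real_tiling (fs' @ gs'))"
      by (simp add: fs' gs' real_tiling_append)
    also have "\<dots> = cls (fs' @ gs')"
      using fs' gs' sim_closed closed_append by (intro domino_class_eq) auto
    also have "\<dots> = cls (fs @ gs)"
      by (rule cls_eqI[OF sim_append[OF sim_sym[OF fs'(4)] sim_sym[OF gs'(4)]]])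
    finally show ?thesis .
  qed
  have "cls hs \<noteq> {}" if "closed_walk hs" for hs
    by (rule cls_nonempty_rep[OF that]) (auto simp: cls_def)
  then obtain N\<^sub>0 t\<^sub>0 N\<^sub>1 t\<^sub>1 where ne: "(N\<^sub>0, t\<^sub>0) \<in> cls fs" "(N\<^sub>1, t\<^sub>1) \<in> cls gs"
    using assms by (metis ex_in_conv surj_pair)
  have "cls fs \<otimes>\<^bsub>G\<^esub> cls gs =
      (\<Union>(N\<^sub>0, t\<^sub>0)\<in>cls fs. \<Union>(N\<^sub>1, t\<^sub>1)\<in>cls gs. domino_class D (N\<^sub>0 + N\<^sub>1) (stack N\<^sub>0 t\<^sub>0 t\<^sub>1))"
    by (simp add: domino_group_def)
  also have "\<dots> = (\<Union>x\<in>cls fs. \<Union>y\<in>cls gs. cls (fs @ gs))"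
    by (intro SUP_cong refl) (auto simp: const)
  also have "\<dots> = cls (fs @ gs)"
    using ne by blast
  finally show ?thesis ..
qed

lemma cls_reflect_left:
  assumes "closed_walk fs"
  shows "cls (reflect fs) \<otimes>\<^bsub>G\<^esub> cls fs = \<one>\<^bsub>G\<^esub>"
proof -
  have cl: "closed_walk (reflect fs)"
    using assms by (rule walk_reflect)
  have "cls ([] @ reflect fs @ reflect (reflect fs) @ []) = cls ([] @ [])"
    using cl by (intro cls_cancel[of _ "{}" _ "{}"]) auto
  then show ?thesis
    using cls_append[OF cl assms] by (simp add: one_eq)
qed

lemma group_G: "group G"
proof (rule groupI)
  fix x y assume "x \<in> carrier G" "y \<in> carrier G"
  then show "x \<otimes>\<^bsub>G\<^esub> y \<in> carrier G"
    using cls_append closed_append by (auto simp: carrier_eq simp flip: cls_append)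
next
  fix x y z assume "x \<in> carrier G" "y \<in> carrier G" "z \<in> carrier G"
  then show "x \<otimes>\<^bsub>G\<^esub> y \<otimes>\<^bsub>G\<^esub> z = x \<otimes>\<^bsub>G\<^esub> (y \<otimes>\<^bsub>G\<^esub> z)"
    using closed_append by (auto simp: carrier_eq simp flip: cls_append)
next
  fix x assume "x \<in> carrier G"
  then show "\<one>\<^bsub>G\<^esub> \<otimes>\<^bsub>G\<^esub> x = x"
    by (auto simp: carrier_eq one_eq simp flip: cls_append)
next
  fix x assume "x \<in> carrier G"
  then show "\<exists>y\<in>carrier G. y \<otimes>\<^bsub>G\<^esub> x = \<one>\<^bsub>G\<^esub>"
    using cls_reflect_left walk_reflect unfolding carrier_eq by blast
qed (simp add: one_eq)

lemma cls_reflect: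
  assumes "closed_walk fs"
  shows "cls (reflect fs) = inv\<^bsub>G\<^esub> cls fs"
  using group.inv_equality[OF group_G cls_reflect_left[OF assms]] assms walk_reflect by simp

text \<open>Heights within one class agree modulo 2, so the parity of a class can be read off from any of
  its walks.\<close>

lemma odd_walk_of_not_even:
  assumes "x \<in> carrier G" "x \<notin> even_domino_group D"
  obtains fs where "closed_walk fs" "x = cls fs" "odd (length fs)"
proof -
  obtain fs' where fs': "closed_walk fs'" "x = cls fs'"
    using assms(1) unfolding carrier_eq by blast
  obtain fs where fs: "closed_walk fs" "fs \<noteq> []" "x = cls fs"
    by (rule cls_nonempty_rep[OF fs'(1)]) (simp add: fs'(2))
  have mem: "(length fs, real_tiling fs) \<in> cls fs"
    using fs sim_refl by (auto simp: cls_def)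
  have "(\<lambda>(N, t). int N mod 2) ` cls fs = {int (length fs) mod 2}"
  proof (intro equalityI subsetI)
    fix y assume "y \<in> (\<lambda>(N, t). int N mod 2) ` cls fs"
    then obtain gs where "sim fs gs" "y = int (length gs) mod 2"
      by (auto simp: cls_def)
    then show "y \<in> {int (length fs) mod 2}"
      using sim_length[of fs gs] by (simp flip: zmod_int) presburger
  next
    fix y assume "y \<in> {int (length fs) mod 2}"
    then show "y \<in> (\<lambda>(N, t). int N mod 2) ` cls fs"
      using mem by force
  qed
  then have "domino_parity x = int (length fs) mod 2"
    by (simp add: domino_parity_def fs(3))
  moreover have "domino_parity x \<noteq> 0"
    using assms by (auto simp: even_domino_group_def kernel_def integer_mod_group_def)
  ultimately have "odd (length fs)"
    by presburger
  with fs show ?thesis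
    by (intro that[of fs])
qed

end

section \<open>Contraction towards the uniform distribution\<close>

text \<open>The contraction step. If every value of \<open>Q\<close> is hit, choose for each of them one preimage: over
  these the values \<open>f (\<pi> v) - M\<close> add up to zero, so only the remaining \<open>card V - card Q\<close> terms
  contribute to the deviation. Since there is at least one term to save among at most \<open>C\<close>, the
  relative deviation shrinks by the factor \<open>1 - 1 / C\<close>.\<close>

lemma sum_over_surjection_near_mean:
  fixes f :: "'q \<Rightarrow> real"
  assumes "finite V" "finite Q" "Q \<noteq> {}" "\<pi> ` V = Q"
    and mean: "M = sum f Q / real (card Q)"
    and near: "\<And>y. y \<in> Q \<Longrightarrow> \<bar>f y - M\<bar> \<le> d"
    and C: "real (card V) \<le> C"
  shows "\<bar>(\<Sum>v\<in>V. f (\<pi> v)) - real (card V) * M\<bar> \<le> (1 - 1 / C) * (real (card V) * d)"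
proof -
  obtain U where U: "U \<subseteq> V" "inj_on \<pi> U" "Q = \<pi> ` U"
    using subset_image_inj[of Q \<pi> V] assms(4) by auto
  have fin: "finite U"
    using U(1) assms(1) finite_subset by blast
  have cQ: "card Q = card U" "card Q \<ge> 1"
    using U(2,3) fin assms(3) by (auto simp: card_image Suc_le_eq card_gt_0_iff)
  obtain y where "y \<in> Q"
    using assms(3) by blast
  then have "d \<ge> 0"
    using near[of y] by linarith
  have "card U \<le> card V"
    using U(1) assms(1) by (rule card_mono[rotated])
  then have V1: "real (card V) \<ge> 1" "C > 0"
    using cQ C by linarith+
  have "(\<Sum>v\<in>U. f (\<pi> v) - M) = (\<Sum>y\<in>Q. f y - M)"
    unfolding U(3) by (simp add: sum.reindex[OF U(2)])
  also have "\<dots> = 0"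
    using cQ mean by (simp add: sum_subtractf)
  finally have U0: "(\<Sum>v\<in>U. f (\<pi> v) - M) = 0" .
  have "(\<Sum>v\<in>V. f (\<pi> v)) - real (card V) * M = (\<Sum>v\<in>V. f (\<pi> v) - M)"
    by (simp add: sum_subtractf)
  also have "\<dots> = (\<Sum>v\<in>V - U. f (\<pi> v) - M)"
    using sum.subset_diff[OF U(1) assms(1), of "\<lambda>v. f (\<pi> v) - M"] U0 by simp
  finally have "\<bar>(\<Sum>v\<in>V. f (\<pi> v)) - real (card V) * M\<bar> \<le> (\<Sum>v\<in>V - U. \<bar>f (\<pi> v) - M\<bar>)"
    by (simp add: sum_abs)
  also have "\<dots> \<le> real (card (V - U)) * d"
    using near assms(4) by (intro sum_bounded_above) auto
  also have "real (card (V - U)) = real (card V) - real (card U)"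
    using U(1) fin \<open>card U \<le> card V\<close> by (simp add: card_Diff_subset of_nat_diff)
  also have "(real (card V) - real (card U)) * d \<le> ((1 - 1 / C) * real (card V)) * d"
  proof (rule mult_right_mono)
    have "real (card V) / C \<le> 1"
      using C V1 by simp
    also have "1 \<le> real (card U)"
      using cQ by simp
    finally show "real (card V) - real (card U) \<le> (1 - 1 / C) * real (card V)"
      by (simp add: algebra_simps)
  qed fact
  finally show ?thesis
    by (simp only: mult.assoc)
qed

section \<open>Counting walks by right coset\<close>

locale finite_index = region +
  fixes K :: "(nat \<times> tiling) set set"
  assumes subgroup_K: "subgroup K (domino_group D)"
    and finite_cosets: "finite (rcosets\<^bsub>domino_group D\<^esub> K)"
    and not_even: "\<not> K \<subseteq> even_domino_group D"
begin

abbreviation "Q \<equiv> rcosets\<^bsub>G\<^esub> K"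

definition walks :: "cell set \<Rightarrow> nat \<Rightarrow> cell set \<Rightarrow> layer list set" where
  "walks p N q = {fs. walk p fs q \<and> length fs = N}"

text \<open>Only plugs from which a walk can be completed occur inside tilings.\<close>

definition plugs :: "cell set set" where
  "plugs = {p. \<exists>s. walk p s {}}"

text \<open>A fixed completion of each plug. For the empty plug it has to be the empty walk, so that closed
  walks are labelled by their own class.\<close>

definition cap :: "cell set \<Rightarrow> layer list" where
  "cap p = (if p = {} then [] else SOME s. walk p s {})"

definition label :: "layer list \<Rightarrow> (nat \<times> tiling) set set" where
  "label fs = K #>\<^bsub>G\<^esub> cls fs"

definition coset_count :: "nat \<Rightarrow> cell set \<Rightarrow> (nat \<times> tiling) set set \<Rightarrow> nat" where
  "coset_count N p x = card {u \<in> walks {} N p. label (u @ cap p) = x}"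

text \<open>The closed walk obtained by joining both ends of \<open>v\<close> to the empty plug along the fixed
  completions; its class is the group element by which \<open>v\<close> acts on cosets.\<close>

definition loop :: "cell set \<Rightarrow> layer list \<Rightarrow> cell set \<Rightarrow> layer list" where
  "loop p v q = reflect (cap p) @ v @ cap q"

lemma finite_walks_set [simp]: "finite (walks p N q)"
  unfolding walks_def by (rule finite_walks)

lemma plug_subset: "p \<in> plugs \<Longrightarrow> p \<subseteq> S"
  unfolding plugs_def using walk_subset by blast

lemma finite_plugs: "finite plugs"
  using finite_S plug_subset by (meson PowI finite_Pow_iff finite_subset subsetI)

lemma empty_plug [simp]: "{} \<in> plugs"
  unfolding plugs_def by (metis mem_Collect_eq walk.simps(1))

lemma cap_empty [simp]: "cap {} = []"
  by (simp add: cap_def)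

lemma walk_cap: "p \<in> plugs \<Longrightarrow> walk p (cap p) {}"
  unfolding cap_def plugs_def by (auto intro: someI_ex)

lemma walk_uncap: "p \<in> plugs \<Longrightarrow> walk {} (reflect (cap p)) p"
  by (intro walk_reflect walk_cap)

lemma closed_loop: "p \<in> plugs \<Longrightarrow> q \<in> plugs \<Longrightarrow> walk p v q \<Longrightarrow> closed_walk (loop p v q)"
  unfolding loop_def using walk_cap walk_uncap by (auto simp: walk_append)

lemma K_subset: "K \<subseteq> carrier G"
  using subgroup_K by (rule subgroup.subset)

lemma coset_cls: "x \<in> Q \<longleftrightarrow> (\<exists>fs. closed_walk fs \<and> x = label fs)"
  unfolding RCOSETS_def carrier_eq label_def by blast

lemma label_in: "closed_walk fs \<Longrightarrow> label fs \<in> Q"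
  using coset_cls by blast

lemma label_append:
  assumes "closed_walk fs" "closed_walk gs"
  shows "label (fs @ gs) = label fs #>\<^bsub>G\<^esub> cls gs"
  unfolding label_def
  by (simp add: cls_append assms group.coset_mult_assoc[OF group_G] K_subset)

lemma coset_subset: "x \<in> Q \<Longrightarrow> x \<subseteq> carrier G"
  using group.rcosets_subset_PowG[OF group_G subgroup_K] by blast

lemma coset_mult_in:
  assumes "x \<in> Q" "g \<in> carrier G"
  shows "x #>\<^bsub>G\<^esub> g \<in> Q"
proof -
  obtain fs gs where fg: "closed_walk fs" "x = label fs" "closed_walk gs" "g = cls gs"
    using assms coset_cls unfolding carrier_eq by auto
  then show ?thesis
    using label_in[OF closed_append[OF fg(1,3)]] label_append[OF fg(1,3)] by simp
qed

lemma coset_mult_eq_iff: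
  assumes "x \<in> Q" "y \<in> Q" "g \<in> carrier G"
  shows "y #>\<^bsub>G\<^esub> g = x \<longleftrightarrow> y = x #>\<^bsub>G\<^esub> (inv\<^bsub>G\<^esub> g)"
proof -
  interpret group G by (rule group_G)
  show ?thesis
    using assms coset_subset by (auto simp: coset_mult_assoc)
qed

text \<open>Appending \<open>v\<close> changes the label by a group element that depends on \<open>v\<close> only: insert
  \<open>cap p @ reflect (cap p)\<close> at the cut.\<close>

lemma label_cut:
  assumes "walk {} u p" "walk p v q" "q \<in> plugs" "p \<in> plugs"
  shows "label (u @ v @ cap q) = label (u @ cap p) #>\<^bsub>G\<^esub> cls (loop p v q)"
proof -
  have "walk p (v @ cap q) {}"
    using assms walk_cap by (auto simp: walk_append)
  then have "cls (u @ cap p @ reflect (cap p) @ v @ cap q) = cls (u @ v @ cap q)"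
    using assms walk_cap by (intro cls_cancel) auto
  moreover have "closed_walk (u @ cap p)"
    using assms walk_cap by (auto simp: walk_append)
  ultimately show ?thesis
    using label_append[of "u @ cap p" "loop p v q"] closed_loop assms
    by (simp add: label_def loop_def)
qed

text \<open>Every group element is realised by a walk between any two given plugs: run from \<open>p\<close> to the
  empty plug, through \<open>t\<close>, and on to \<open>q\<close>; the completions cancel.\<close>

lemma cls_loop_uncap:
  assumes "p \<in> plugs" "q \<in> plugs" "closed_walk t"
  shows "cls (loop p (cap p @ t @ reflect (cap q)) q) = cls t"
proof -
  have 1: "cls ([] @ reflect (cap r) @ reflect (reflect (cap r)) @ w) = cls ([] @ w)"
    if "r \<in> plugs" "closed_walk w" for r w
    using that walk_uncap plug_subset by (intro cls_cancel[of _ "{}" _ r]) auto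
  have 2: "cls (t @ reflect (cap r) @ reflect (reflect (cap r)) @ []) = cls (t @ [])"
    if "r \<in> plugs" for r
    using that assms(3) walk_uncap plug_subset by (intro cls_cancel[of _ "{}" _ r]) auto
  have "closed_walk (t @ reflect (cap q) @ cap q)"
    using assms walk_cap walk_uncap by (auto simp: walk_append)
  then have "cls (loop p (cap p @ t @ reflect (cap q)) q) = cls (t @ reflect (cap q) @ cap q)"
    using 1[OF assms(1)] by (simp add: loop_def)
  also have "\<dots> = cls t"
    using 2[OF assms(2)] by simp
  finally show ?thesis .
qed

text \<open>Walks of length \<open>N + m\<close> are sorted by the plug at height \<open>N\<close> and the part above it.\<close>

lemma card_split:
  assumes "q \<in> plugs"
  shows "card {w \<in> walks {} (N + m) q. R w} =
    (\<Sum>p\<in>plugs. \<Sum>v\<in>walks p m q. card {u \<in> walks {} N p. R (u @ v)})"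
proof -
  let ?I = "SIGMA p:plugs. walks p m q"
  let ?A = "\<lambda>(p, v). {u \<in> walks {} N p. R (u @ v)}"
  let ?f = "\<lambda>((p :: cell set, v), u :: layer list). u @ v"
  have "bij_betw ?f (Sigma ?I ?A) {w \<in> walks {} (N + m) q. R w}"
  proof (rule bij_betwI')
    fix a b assume "a \<in> Sigma ?I ?A" "b \<in> Sigma ?I ?A"
    then obtain p v u p' v' u' where ab: "a = ((p, v), u)" "b = ((p', v'), u')"
      and w: "walk {} u p" "length u = N" "walk {} u' p'" "length u' = N"
      by (auto simp: walks_def)
    have "u = u' \<Longrightarrow> p = p'"
      using w walk_functional by blast
    then show "?f a = ?f b \<longleftrightarrow> a = b"
      using w unfolding ab by auto
  next
    fix a assume "a \<in> Sigma ?I ?A"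
    then show "?f a \<in> {w \<in> walks {} (N + m) q. R w}"
      by (auto simp: walks_def walk_append)
  next
    fix w assume w: "w \<in> {w \<in> walks {} (N + m) q. R w}"
    define u where "u = take N w"
    define v where "v = drop N w"
    have uv: "w = u @ v" "length u = N" "length v = m"
      using w by (auto simp: u_def v_def walks_def)
    then obtain p where p: "walk {} u p" "walk p v q"
      using w by (auto simp: walks_def walk_append)
    have "p \<in> plugs"
      using p(2) walk_cap[OF assms] walk_append unfolding plugs_def by blast
    then have "((p, v), u) \<in> Sigma ?I ?A"
      using p uv w by (auto simp: walks_def)
    then show "\<exists>a\<in>Sigma ?I ?A. w = ?f a"
      using uv(1) by (intro bexI[of _ "((p, v), u)"]) auto
  qed
  then have "card {w \<in> walks {} (N + m) q. R w} = card (Sigma ?I ?A)"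
    by (rule bij_betw_same_card[symmetric])
  also have "\<dots> = (\<Sum>i\<in>?I. card (?A i))"
    using finite_plugs by (intro card_SigmaI) auto
  also have "\<dots> = (\<Sum>p\<in>plugs. \<Sum>v\<in>walks p m q. card {u \<in> walks {} N p. R (u @ v)})"
    using finite_plugs by (subst sum.Sigma) (auto intro!: sum.cong)
  finally show ?thesis .
qed

text \<open>For a fixed upper part \<open>v\<close>, the counts below are permuted by a group element acting on \<open>Q\<close>.\<close>

lemma coset_count_split:
  assumes "q \<in> plugs" "x \<in> Q"
  shows "coset_count (N + m) q x =
    (\<Sum>p\<in>plugs. \<Sum>v\<in>walks p m q. coset_count N p (x #>\<^bsub>G\<^esub> inv\<^bsub>G\<^esub> (cls (loop p v q))))"
  unfolding coset_count_def card_split[OF assms(1)]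
proof (intro sum.cong refl arg_cong[where f = card] Collect_cong conj_cong)
  fix p v u assume pv: "p \<in> plugs" "v \<in> walks p m q" and u: "u \<in> walks {} N p"
  have w: "walk {} u p" "walk p v q"
    using pv u by (auto simp: walks_def)
  have "closed_walk (u @ cap p)"
    using w walk_cap[OF pv(1)] by (auto simp: walk_append)
  then have "label (u @ cap p) \<in> Q"
    by (rule label_in)
  then show "label ((u @ v) @ cap q) = x \<longleftrightarrow>
      label (u @ cap p) = x #>\<^bsub>G\<^esub> inv\<^bsub>G\<^esub> (cls (loop p v q))"
    using label_cut[OF w assms(1) pv(1)] closed_loop[OF pv(1) assms(1) w(2)]
      coset_mult_eq_iff[OF assms(2)] by simp
qed

lemma card_walks_split:
  assumes "q \<in> plugs"
  shows "card (walks {} (N + m) q) = (\<Sum>p\<in>plugs. card (walks p m q) * card (walks {} N p))"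
  using card_split[OF assms, of N m "\<lambda>_. True"] by simp

lemma sum_count:
  assumes "p \<in> plugs"
  shows "(\<Sum>x\<in>Q. coset_count N p x) = card (walks {} N p)"
proof -
  have "label (u @ cap p) \<in> Q" if "u \<in> walks {} N p" for u
    using that walk_cap[OF assms] by (intro label_in) (auto simp: walks_def walk_append)
  then have "(\<Union>x\<in>Q. {u \<in> walks {} N p. label (u @ cap p) = x}) = walks {} N p"
    by auto
  then show ?thesis
    unfolding coset_count_def by (subst card_UN_disjoint[symmetric]) (auto simp: finite_cosets)
qed

lemma Q_nonempty: "Q \<noteq> {}"
  using label_in[of "[]"] by auto

text \<open>Any coset is reached from any other by some tiling, and an odd element of \<open>K\<close> allows its
  height to have either parity.\<close>

lemma transitive:
  assumes "x \<in> Q" "y \<in> Q"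
  shows "\<exists>N\<^sub>0. \<forall>N\<ge>N\<^sub>0. \<exists>t. closed_walk t \<and> length t = N \<and> y #>\<^bsub>G\<^esub> cls t = x"
proof -
  obtain a where a: "closed_walk a" "y = label a"
    using assms(2) coset_cls by blast
  obtain b where b: "closed_walk b" "x = label b"
    using assms(1) coset_cls by blast
  obtain g where "g \<in> K" "g \<notin> even_domino_group D"
    using not_even by blast
  then obtain k where k: "closed_walk k" "g = cls k" "odd (length k)"
    using odd_walk_of_not_even[OF subsetD[OF K_subset]] by auto
  have fix_K: "label k = label []"
  proof -
    interpret group G by (rule group_G)
    show ?thesis
      unfolding label_def one_eq[symmetric]
      using \<open>g \<in> K\<close> k(2) subgroup_K K_subset by (simp add: coset_join2 subsetD)
  qed
  have ra: "closed_walk (reflect a)"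
    using a(1) by (rule walk_reflect)
  have cancel: "label (a @ reflect a @ w) = label w" if "closed_walk w" for w
    unfolding label_def using cls_cancel[of "[]" "{}" a "{}" w] a that by simp
  define L where "L = length a + length b"
  have even_case: "y #>\<^bsub>G\<^esub> cls (reflect a @ b @ verticals j) = x" for j
  proof -
    have "y #>\<^bsub>G\<^esub> cls (reflect a @ b @ verticals j) = label (a @ reflect a @ b @ verticals j)"
      unfolding a(2) using a b ra closed_append by (intro label_append[symmetric]) auto
    also have "\<dots> = label (b @ verticals j)"
      using b closed_append by (intro cancel) auto
    also have "\<dots> = x"
      using cls_verticals b by (simp add: label_def)
    finally show ?thesis .
  qed
  have odd_case: "y #>\<^bsub>G\<^esub> cls (reflect a @ k @ b @ verticals j) = x" for j
  proof -
    have "y #>\<^bsub>G\<^esub> cls (reflect a @ k @ b @ verticals j) = label (a @ reflect a @ k @ b @ verticals j)"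
      unfolding a(2) using a b k ra closed_append by (intro label_append[symmetric]) auto
    also have "\<dots> = label (k @ b @ verticals j)"
      using b k closed_append by (intro cancel) auto
    also have "\<dots> = label ([] @ b @ verticals j)"
      using b k closed_append fix_K label_append[of k "b @ verticals j"]
        label_append[of "[]" "b @ verticals j"] by simp
    also have "\<dots> = x"
      using cls_verticals b by (simp add: label_def)
    finally show ?thesis .
  qed
  have "\<exists>t. closed_walk t \<and> length t = N \<and> y #>\<^bsub>G\<^esub> cls t = x" if N: "N \<ge> L + length k" for N
  proof (cases "even (N - L)")
    case True
    then have "length (reflect a @ b @ verticals ((N - L) div 2)) = N"
      using N by (simp add: L_def)
    moreover have "closed_walk (reflect a @ b @ verticals ((N - L) div 2))"
      using ra b closed_append by auto
    ultimately show ?thesis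
      using even_case by blast
  next
    case False
    then have "even (N - L - length k)"
      using k(3) N by simp
    then have "length (reflect a @ k @ b @ verticals ((N - L - length k) div 2)) = N"
      using N by (simp add: L_def)
    moreover have "closed_walk (reflect a @ k @ b @ verticals ((N - L - length k) div 2))"
      using ra b k closed_append by auto
    ultimately show ?thesis
      using odd_case by blast
  qed
  then show ?thesis
    by blast
qed

lemma eventually_transitive:
  "\<forall>\<^sub>F N in sequentially. \<forall>x\<in>Q. \<forall>y\<in>Q. \<exists>t. closed_walk t \<and> length t = N \<and> y #>\<^bsub>G\<^esub> cls t = x"
  using transitive finite_cosets
  by (intro eventually_ball_finite ballI) (auto simp: eventually_sequentially)

text \<open>For all large \<open>m\<close>, walks of length \<open>m\<close> between two given plugs move a given coset to every other
  coset. The length has to be common to all plugs and cosets, of which there are finitely many.\<close>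

lemma eventually_mixing:
  "\<forall>\<^sub>F m in sequentially. \<forall>p\<in>plugs. \<forall>q\<in>plugs. \<forall>x\<in>Q.
     (\<lambda>v. x #>\<^bsub>G\<^esub> inv\<^bsub>G\<^esub> (cls (loop p v q))) ` walks p m q = Q"
proof (intro eventually_ball_finite ballI finite_plugs finite_cosets)
  fix p q x assume p: "p \<in> plugs" and q: "q \<in> plugs" and x: "x \<in> Q"
  let ?l = "length (cap p) + length (cap q)"
  obtain N\<^sub>0 where N\<^sub>0: "\<forall>N\<ge>N\<^sub>0. \<forall>x\<in>Q. \<forall>y\<in>Q.
      \<exists>t. closed_walk t \<and> length t = N \<and> y #>\<^bsub>G\<^esub> cls t = x"
    using eventually_transitive unfolding eventually_sequentially ..
  have "(\<lambda>v. x #>\<^bsub>G\<^esub> inv\<^bsub>G\<^esub> (cls (loop p v q))) ` walks p m q = Q" if m: "m \<ge> N\<^sub>0 + ?l" for m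
  proof (intro equalityI subsetI)
    fix y assume "y \<in> (\<lambda>v. x #>\<^bsub>G\<^esub> inv\<^bsub>G\<^esub> (cls (loop p v q))) ` walks p m q"
    then obtain v where v: "walk p v q" "y = x #>\<^bsub>G\<^esub> inv\<^bsub>G\<^esub> (cls (loop p v q))"
      by (auto simp: walks_def)
    have "inv\<^bsub>G\<^esub> (cls (loop p v q)) \<in> carrier G"
      by (intro group.inv_closed[OF group_G] cls_in_carrier closed_loop p q v(1))
    then show "y \<in> Q"
      unfolding v(2) by (intro coset_mult_in x)
  next
    fix y assume y: "y \<in> Q"
    have "m - ?l \<ge> N\<^sub>0"
      using m by simp
    then obtain t where t: "closed_walk t" "length t = m - ?l" "y #>\<^bsub>G\<^esub> cls t = x"
      using N\<^sub>0 x y by blast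
    let ?v = "cap p @ t @ reflect (cap q)"
    have "walk p ?v q" "length ?v = m"
      using t m walk_cap[OF p] walk_uncap[OF q] by (auto simp: walk_append)
    moreover have "y = x #>\<^bsub>G\<^esub> inv\<^bsub>G\<^esub> (cls (loop p ?v q))"
      unfolding cls_loop_uncap[OF p q t(1)] using coset_mult_eq_iff[OF x y] t by simp
    ultimately show "y \<in> (\<lambda>v. x #>\<^bsub>G\<^esub> inv\<^bsub>G\<^esub> (cls (loop p v q))) ` walks p m q"
      by (intro image_eqI[of _ _ ?v]) (auto simp: walks_def)
  qed
  then show "\<forall>\<^sub>F m in sequentially.
      (\<lambda>v. x #>\<^bsub>G\<^esub> inv\<^bsub>G\<^esub> (cls (loop p v q))) ` walks p m q = Q"
    unfolding eventually_sequentially by blast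
qed

definition mean :: "nat \<Rightarrow> cell set \<Rightarrow> real" where
  "mean N p = real (card (walks {} N p)) / real (card Q)"

lemma card_Q: "real (card Q) \<ge> 1"
  using Q_nonempty finite_cosets by (simp add: Suc_le_eq card_gt_0_iff)

lemma mean_nonneg: "mean N p \<ge> 0"
  by (simp add: mean_def)

lemma mean_eq: "p \<in> plugs \<Longrightarrow> mean N p = (\<Sum>x\<in>Q. real (coset_count N p x)) / real (card Q)"
  unfolding mean_def by (simp flip: sum_count)

lemma mean_split: "q \<in> plugs \<Longrightarrow> mean (N + m) q = (\<Sum>p\<in>plugs. real (card (walks p m q)) * mean N p)"
  unfolding mean_def by (simp add: card_walks_split sum_divide_distrib)

text \<open>Every further block of \<open>m\<close> floors improves the relative deviation from equal counts by the
  factor \<open>1 - 1 / C\<close>: this holds for each plug at the lower end of the block separately, hence for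
  the sum over all plugs.\<close>

lemma coset_count_near_mean:
  assumes m: "\<And>p q x. p \<in> plugs \<Longrightarrow> q \<in> plugs \<Longrightarrow> x \<in> Q \<Longrightarrow>
      (\<lambda>v. x #>\<^bsub>G\<^esub> inv\<^bsub>G\<^esub> (cls (loop p v q))) ` walks p m q = Q"
    and C: "\<And>p q. p \<in> plugs \<Longrightarrow> q \<in> plugs \<Longrightarrow> real (card (walks p m q)) \<le> C"
    and q: "q \<in> plugs" and x: "x \<in> Q"
  shows "\<bar>real (coset_count (r + k * m) q x) - mean (r + k * m) q\<bar>
    \<le> real (card Q) * (1 - 1 / C) ^ k * mean (r + k * m) q"
  using q x
proof (induction k arbitrary: q x)
  case 0
  \<comment> \<open>a single count is at most the total, which is \<open>card Q\<close> times the mean\<close>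
  have "coset_count r q x \<le> card (walks {} r q)"
    unfolding coset_count_def by (intro card_mono) auto
  then have "real (coset_count r q x) \<le> real (card Q) * mean r q"
    using card_Q by (simp add: mean_def)
  moreover have "mean r q \<le> real (card Q) * mean r q"
    using mult_right_mono[OF card_Q mean_nonneg[of r q]] by simp
  ultimately have "\<bar>real (coset_count r q x) - mean r q\<bar> \<le> real (card Q) * mean r q"
    using mean_nonneg[of r q] by linarith
  then show ?case
    by simp
next
  case (Suc k)
  let ?N = "r + k * m"
  let ?\<delta> = "real (card Q) * (1 - 1 / C) ^ k"
  let ?\<pi> = "\<lambda>p v. x #>\<^bsub>G\<^esub> inv\<^bsub>G\<^esub> (cls (loop p v q))"
  have N: "r + Suc k * m = ?N + m"
    by simp
  have "\<bar>real (coset_count (?N + m) q x) - mean (?N + m) q\<bar> =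
      \<bar>\<Sum>p\<in>plugs. (\<Sum>v\<in>walks p m q. real (coset_count ?N p (?\<pi> p v))) - real (card (walks p m q)) * mean ?N p\<bar>"
    by (simp add: coset_count_split[OF Suc.prems] mean_split[OF Suc.prems(1)] sum_subtractf)
  also have "\<dots> \<le> (\<Sum>p\<in>plugs. \<bar>(\<Sum>v\<in>walks p m q. real (coset_count ?N p (?\<pi> p v)))
      - real (card (walks p m q)) * mean ?N p\<bar>)"
    by (rule sum_abs)
  also have "\<dots> \<le> (\<Sum>p\<in>plugs. (1 - 1 / C) * (real (card (walks p m q)) * (?\<delta> * mean ?N p)))"
    by (intro sum_mono sum_over_surjection_near_mean[of _ Q])
      (use Suc finite_cosets Q_nonempty m C mean_eq in auto)
  also have "\<dots> = real (card Q) * (1 - 1 / C) ^ Suc k * mean (?N + m) q"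
    by (simp add: mean_split[OF Suc.prems(1)] sum_distrib_left mult_ac)
  finally show ?case
    unfolding N .
qed

text \<open>For small heights there may be no tiling at all, and then the uniform distribution on
  \<open>tilings D N\<close> is unspecified.\<close>

lemma eventually_tilings: "\<forall>\<^sub>F N in sequentially. walks {} N {} \<noteq> {}"
  using eventually_transitive
proof (rule eventually_mono)
  fix N assume "\<forall>x\<in>Q. \<forall>y\<in>Q. \<exists>t. closed_walk t \<and> length t = N \<and> y #>\<^bsub>G\<^esub> cls t = x"
  then obtain t where "closed_walk t" "length t = N"
    using Q_nonempty by (metis ex_in_conv)
  then show "walks {} N {} \<noteq> {}"
    by (auto simp: walks_def)
qed

theorem right_coset_limit:
  assumes x: "x \<in> Q"
  shows "(\<lambda>N. real (card {fs \<in> walks {} N {}. label fs = x}) / real (card (walks {} N {})))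
    \<longlonglongrightarrow> 1 / real (card Q)"
proof -
  have "\<exists>m. m \<ge> 1 \<and> (\<forall>p\<in>plugs. \<forall>q\<in>plugs. \<forall>x\<in>Q.
     (\<lambda>v. x #>\<^bsub>G\<^esub> inv\<^bsub>G\<^esub> (cls (loop p v q))) ` walks p m q = Q)"
    by (rule eventually_happens'[OF sequentially_bot])
      (intro eventually_conj eventually_ge_at_top eventually_mixing)
  then obtain m where m\<^sub>0: "m \<ge> 1 \<and> (\<forall>p\<in>plugs. \<forall>q\<in>plugs. \<forall>x\<in>Q.
     (\<lambda>v. x #>\<^bsub>G\<^esub> inv\<^bsub>G\<^esub> (cls (loop p v q))) ` walks p m q = Q)" ..
  have m: "m \<ge> 1" "\<And>p q x. p \<in> plugs \<Longrightarrow> q \<in> plugs \<Longrightarrow> x \<in> Q \<Longrightarrow>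
      (\<lambda>v. x #>\<^bsub>G\<^esub> inv\<^bsub>G\<^esub> (cls (loop p v q))) ` walks p m q = Q"
    using m\<^sub>0 by simp_all
  \<comment> \<open>the summand 1 gives \<open>C \<ge> 1\<close>, hence a contraction factor in \<open>[0, 1)\<close>\<close>
  define C where "C = 1 + (\<Sum>p\<in>plugs. \<Sum>q\<in>plugs. real (card (walks p m q)))"
  have C: "real (card (walks p m q)) \<le> C" if "p \<in> plugs" "q \<in> plugs" for p q
  proof -
    have "real (card (walks p m q)) \<le> (\<Sum>q\<in>plugs. real (card (walks p m q)))"
      by (rule member_le_sum) (use that finite_plugs in auto)
    also have "\<dots> \<le> (\<Sum>p\<in>plugs. \<Sum>q\<in>plugs. real (card (walks p m q)))"
      by (rule member_le_sum) (use that finite_plugs in \<open>auto intro: sum_nonneg\<close>)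
    finally show ?thesis
      by (simp add: C_def)
  qed
  have "C \<ge> 1"
    by (simp add: C_def sum_nonneg)
  then have \<theta>: "norm (1 - 1 / C) < 1"
    by (simp add: field_simps)
  let ?P = "\<lambda>N. real (card {fs \<in> walks {} N {}. label fs = x}) / real (card (walks {} N {}))"
  \<comment> \<open>for the empty plug the mean is the number of tilings divided by \<open>card Q\<close>\<close>
  have bound: "norm (?P N - 1 / real (card Q)) \<le> (1 - 1 / C) ^ (N div m)"
    if "walks {} N {} \<noteq> {}" for N
  proof -
    have pos: "mean N {} > 0"
      using that Q_nonempty finite_cosets unfolding mean_def
      by (intro divide_pos_pos) (simp_all add: card_gt_0_iff)
    have "\<bar>real (coset_count N {} x) - mean N {}\<bar> \<le> real (card Q) * (1 - 1 / C) ^ (N div m) * mean N {}"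
      using coset_count_near_mean[OF m(2) C, of "{}" x "N mod m" "N div m"] x by simp
    moreover have "?P N - 1 / real (card Q) = (real (coset_count N {} x) - mean N {}) / (real (card Q) * mean N {})"
    proof -
      have "w / c - 1 / n = (w - c / n) / (n * (c / n))" if "c > 0" "n > 0" for w c n :: real
        using that by (simp add: field_simps)
      from this[of "real (card (walks {} N {}))" "real (card Q)" "real (coset_count N {} x)"] show ?thesis
        using that Q_nonempty finite_cosets by (simp add: mean_def coset_count_def card_gt_0_iff)
    qed
    ultimately show ?thesis
      using pos card_Q by (simp add: abs_mult pos_divide_le_eq mult_ac)
  qed
  have "filterlim (\<lambda>N. N div m) sequentially sequentially"
    using m(1) by (intro filterlim_at_top_div_const_nat) simp
  then have "(\<lambda>N. (1 - 1 / C) ^ (N div m)) \<longlonglongrightarrow> 0"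
    by (rule filterlim_compose[OF LIMSEQ_power_zero[OF \<theta>]])
  moreover have "\<forall>\<^sub>F N in sequentially. norm (?P N - 1 / real (card Q)) \<le> (1 - 1 / C) ^ (N div m)"
    using eventually_tilings by (rule eventually_mono) (rule bound)
  ultimately have "(\<lambda>N. ?P N - 1 / real (card Q)) \<longlonglongrightarrow> 0"
    by (rule Lim_null_comparison[rotated])
  then show ?thesis
    by (simp add: LIM_zero_iff)
qed

end

section \<open>Left cosets and the limit law for tilings\<close>

lemma (in group) inv_image_l_coset:
  assumes "subgroup H G" "a \<in> carrier G"
  shows "m_inv G ` (a <# H) = H #> inv a"
proof -
  have sub: "H \<subseteq> carrier G"
    using assms(1) by (rule subgroup.subset)
  have "inv (a \<otimes> h) = inv h \<otimes> inv a" if "h \<in> H" for h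
    using that sub assms(2) by (intro inv_mult_group) auto
  then have "m_inv G ` (a <# H) = (\<Union>h\<in>H. {inv h \<otimes> inv a})"
    by (simp add: l_coset_def image_UN)
  also have "\<dots> = (\<Union>h\<in>m_inv G ` H. {h \<otimes> inv a})"
    by simp
  also have "m_inv G ` H = H"
  proof (intro equalityI subsetI)
    fix h assume "h \<in> H"
    then show "h \<in> m_inv G ` H"
      using assms(1) sub by (intro image_eqI[of _ _ "inv h"]) (auto simp: subgroup.m_inv_closed)
  qed (use assms(1) in \<open>auto simp: subgroup.m_inv_closed\<close>)
  finally show ?thesis
    by (simp add: r_coset_def)
qed

lemma (in group) bij_betw_lcosets_rcosets:
  assumes "subgroup H G"
  shows "bij_betw (image (m_inv G)) (lcosets H) (rcosets H)"
proof -
  have "inj_on (image (m_inv G)) (Pow (carrier G))"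
    using inv_inj by (rule inj_on_image_Pow)
  moreover have "lcosets H \<subseteq> Pow (carrier G)"
    using subgroup.lcosets_carrier[OF assms is_group] by blast
  ultimately have "inj_on (image (m_inv G)) (lcosets H)"
    by (rule inj_on_subset)
  moreover have "image (m_inv G) ` (lcosets H) = rcosets H"
  proof -
    have "image (m_inv G) ` (lcosets H) = (\<Union>a\<in>carrier G. {H #> inv a})"
      using inv_image_l_coset[OF assms] by (auto simp: LCOSETS_def)
    also have "\<dots> = (\<Union>a\<in>m_inv G ` carrier G. {H #> a})"
      by simp
    also have "m_inv G ` carrier G = carrier G"
    proof (intro equalityI subsetI)
      fix a assume "a \<in> carrier G"
      then show "a \<in> m_inv G ` carrier G"
        by (intro image_eqI[of _ _ "inv a"]) auto
    qed auto
    finally show ?thesis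
      by (simp add: RCOSETS_def)
  qed
  ultimately show ?thesis
    by (simp add: bij_betw_def)
qed

context finite_index
begin

lemma prob_eq_ratio:
  assumes "N \<ge> 1" "walks {} N {} \<noteq> {}"
  shows "measure_pmf.prob (pmf_of_set (tilings D N)) {t. \<psi> (domino_class D N t) = x} =
    real (card {fs \<in> walks {} N {}. \<psi> (cls fs) = x}) / real (card (walks {} N {}))"
proof -
  have bij: "bij_betw real_tiling (walks {} N {}) (tilings D N)"
    using tilings_bij[OF assms(1)] by (simp add: walks_def)
  then have til: "tilings D N = real_tiling ` walks {} N {}" and inj: "inj_on real_tiling (walks {} N {})"
    by (auto simp: bij_betw_def)
  have dc: "domino_class D N (real_tiling fs) = cls fs" if "fs \<in> walks {} N {}" for fs
    using that assms(1) domino_class_eq[of fs] by (cases fs) (auto simp: walks_def)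
  have "tilings D N \<inter> {t. \<psi> (domino_class D N t) = x} =
      real_tiling ` {fs \<in> walks {} N {}. \<psi> (cls fs) = x}"
    unfolding til using dc by auto
  moreover have "card (real_tiling ` {fs \<in> walks {} N {}. \<psi> (cls fs) = x}) =
      card {fs \<in> walks {} N {}. \<psi> (cls fs) = x}"
    by (rule card_image) (rule inj_on_subset[OF inj], blast)
  moreover have "card (tilings D N) = card (walks {} N {})"
    using bij_betw_same_card[OF bij] by simp
  moreover have "tilings D N \<noteq> {}" "finite (tilings D N)"
    using assms(2) by (auto simp: til)
  ultimately show ?thesis
    by (simp add: measure_pmf_of_set)
qed

lemma prob_tendsto:
  assumes "(\<lambda>N. real (card {fs \<in> walks {} N {}. \<psi> (cls fs) = x}) / real (card (walks {} N {})))
    \<longlonglongrightarrow> l"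
  shows "(\<lambda>N. measure_pmf.prob (pmf_of_set (tilings D N)) {t. \<psi> (domino_class D N t) = x})
    \<longlonglongrightarrow> l"
proof (rule Lim_transform_eventually[OF assms])
  show "\<forall>\<^sub>F N in sequentially.
      real (card {fs \<in> walks {} N {}. \<psi> (cls fs) = x}) / real (card (walks {} N {})) =
      measure_pmf.prob (pmf_of_set (tilings D N)) {t. \<psi> (domino_class D N t) = x}"
    using eventually_tilings eventually_ge_at_top[of 1]
    by eventually_elim (simp add: prob_eq_ratio)
qed

text \<open>Inversion in the group exchanges left and right cosets, and it is realised on tilings by the
  reflection, a bijection of the tilings of each height.\<close>

lemma left_coset_limit:
  assumes x: "x \<in> lcosets\<^bsub>G\<^esub> K"
  shows "(\<lambda>N. real (card {fs \<in> walks {} N {}. cls fs <#\<^bsub>G\<^esub> K = x}) / real (card (walks {} N {})))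
    \<longlonglongrightarrow> 1 / real (card (lcosets\<^bsub>G\<^esub> K))"
proof -
  let ?inv = "image (m_inv G)"
  have bij: "bij_betw ?inv (lcosets\<^bsub>G\<^esub> K) Q"
    by (rule group.bij_betw_lcosets_rcosets[OF group_G subgroup_K])
  have label_reflect: "label (reflect fs) = ?inv x \<longleftrightarrow> cls fs <#\<^bsub>G\<^esub> K = x" if "closed_walk fs" for fs
  proof -
    have "label (reflect fs) = ?inv (cls fs <#\<^bsub>G\<^esub> K)"
      using group.inv_image_l_coset[OF group_G subgroup_K cls_in_carrier[OF that]]
      by (simp add: label_def cls_reflect[OF that])
    moreover have "cls fs <#\<^bsub>G\<^esub> K \<in> lcosets\<^bsub>G\<^esub> K"
      using cls_in_carrier[OF that] by (auto simp: LCOSETS_def)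
    ultimately show ?thesis
      using inj_on_eq_iff[OF bij_betw_imp_inj_on[OF bij] _ x] by simp
  qed
  have "bij_betw reflect {fs \<in> walks {} N {}. cls fs <#\<^bsub>G\<^esub> K = x}
      {fs \<in> walks {} N {}. label fs = ?inv x}" for N
  proof (rule bij_betw_byWitness[of _ reflect])
    show "reflect ` {fs \<in> walks {} N {}. cls fs <#\<^bsub>G\<^esub> K = x} \<subseteq> {fs \<in> walks {} N {}. label fs = ?inv x}"
    proof (intro image_subsetI)
      fix fs assume "fs \<in> {fs \<in> walks {} N {}. cls fs <#\<^bsub>G\<^esub> K = x}"
      then show "reflect fs \<in> {fs \<in> walks {} N {}. label fs = ?inv x}"
        using walk_reflect[of "{}" fs "{}"] label_reflect[of fs] by (simp add: walks_def)
    qed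
    show "reflect ` {fs \<in> walks {} N {}. label fs = ?inv x} \<subseteq> {fs \<in> walks {} N {}. cls fs <#\<^bsub>G\<^esub> K = x}"
    proof (intro image_subsetI)
      fix fs assume fs: "fs \<in> {fs \<in> walks {} N {}. label fs = ?inv x}"
      then have "closed_walk (reflect fs)"
        using walk_reflect by (auto simp: walks_def)
      then show "reflect fs \<in> {fs \<in> walks {} N {}. cls fs <#\<^bsub>G\<^esub> K = x}"
        using fs label_reflect[of "reflect fs"] by (simp add: walks_def)
    qed
  qed auto
  then have "card {fs \<in> walks {} N {}. cls fs <#\<^bsub>G\<^esub> K = x} =
      card {fs \<in> walks {} N {}. label fs = ?inv x}" for N
    by (rule bij_betw_same_card)
  moreover have "?inv x \<in> Q"
    using bij x by (auto simp: bij_betw_def)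
  moreover have "card (lcosets\<^bsub>G\<^esub> K) = card Q"
    using bij by (rule bij_betw_same_card)
  ultimately show ?thesis
    using right_coset_limit[of "?inv x"] by simp
qed

end

lemma region_of_quadriculated_disk:
  assumes "quadriculated_disk D"
  obtains S where "region D S"
proof -
  obtain S where S: "finite S" "D = (\<Union>p\<in>S. unit_square p)" and "D homeomorphic cball (0 :: plane) 1"
    using assms unfolding quadriculated_disk_def by blast
  then have "D \<noteq> {}"
    by (metis cball_eq_empty homeomorphic_empty(2) not_one_less_zero)
  then have "region D S"
    using S by unfold_locales auto
  then show ?thesis
    by (rule that)
qed

theorem theorem7:
  fixes D :: "plane set"
    and K :: "(nat \<times> tiling) set set"
    and \<psi> :: "(nat \<times> tiling) set \<Rightarrow> (nat \<times> tiling) set set"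
    and Q :: "(nat \<times> tiling) set set set"
    and n :: nat
  assumes "quadriculated_disk D"
    and "balanced D"
    and "subgroup K (domino_group D)"
    and "(\<psi> = (\<lambda>g. g <#\<^bsub>domino_group D\<^esub> K) \<and> Q = lcosets\<^bsub>domino_group D\<^esub> K) \<or>
         (\<psi> = (\<lambda>g. K #>\<^bsub>domino_group D\<^esub> g) \<and> Q = rcosets\<^bsub>domino_group D\<^esub> K)"
    and "finite Q"
    and "card Q = n"
    and "\<not> K \<subseteq> even_domino_group D"
  shows "\<forall>x\<in>Q. (\<lambda>N. measure_pmf.prob (pmf_of_set (tilings D N))
                      {t. \<psi> (domino_class D N t) = x}) \<longlonglongrightarrow> 1 / real n"
proof
  fix x assume x: "x \<in> Q"
  obtain S where "region D S"
    using assms(1) by (rule region_of_quadriculated_disk)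
  then interpret region D S .
  have "finite (rcosets\<^bsub>domino_group D\<^esub> K)"
    using assms(4,5) bij_betw_finite[OF group.bij_betw_lcosets_rcosets[OF group_G assms(3)]] by auto
  then interpret finite_index D S K
    using assms(3,7) by (intro finite_index.intro finite_index_axioms.intro region_axioms)
  from assms(4) show "(\<lambda>N. measure_pmf.prob (pmf_of_set (tilings D N))
      {t. \<psi> (domino_class D N t) = x}) \<longlonglongrightarrow> 1 / real n"
  proof (elim disjE conjE)
    assume "\<psi> = (\<lambda>g. g <#\<^bsub>domino_group D\<^esub> K)" "Q = lcosets\<^bsub>domino_group D\<^esub> K"
    then show ?thesis
      using left_coset_limit x assms(6) by (intro prob_tendsto) simp
  next
    assume "\<psi> = (\<lambda>g. K #>\<^bsub>domino_group D\<^esub> g)" "Q = rcosets\<^bsub>domino_group D\<^esub> K"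
    then show ?thesis
      using right_coset_limit x assms(6) by (intro prob_tendsto) (simp add: label_def)
  qed
qed

end
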